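(* Let $X$ be a complex Banach space and $J \subset \mathscr{L}(X)$ be a separable Banach ideal. If $A, B \in \mathscr{L}(X)$ are Riesz operators, then the induced generalised derivation $\tau_{A,B} \colon J \to J$, $\tau_{A,B}(T) = AT - TB$, is not hypercyclic.
   Context: $\mathscr{L}(X)$ is the space of bounded linear operators on $X$. An operator $T \in \mathscr{L}(X)$ is a Riesz operator if its essential spectrum (the spectrum of its class in the Calkin algebra $\mathscr{L}(X)/\mathscr{K}(X)$, where $\mathscr{K}(X)$ is the ideal of compact operators) satisfies $\sigma_{\mathrm{e}}(T) = \{0\}$; in particular $X$ is infinite dimensional. Banach ideal: $(J, \lVert\cdot\rVert_J)$ is a Banach ideal of $\mathscr{L}(X)$ if (i) $J \subset \mathscr{L}(X)$ is a linear subspace; (ii) the norm $\lVert\cdot\rVert_J$ is complete in $J$ and $\lVert S\rVert \le \lVert S\rVert_J$ for all $S \in J$; (iii) $BSA \in J$ and $\lVert BSA\rVert_J \le \lVert B\rVert\,\lVert A\rVert\,\lVert S\rVert_J$ for all $A,B \in \mathscr{L}(X)$, $S \in J$; (iv) the rank one operators $x^*\otimes x \colon z \mapsto x^*(z)x$ belong to $J$ and $\lVert x^*\otimes x\rVert_J = \lVert x^*\rVert\,\lVert x\rVert$ for all $x^* \in X^*$, $x \in X$. Separability of $J$ is with respect to $\lVert\cdot\rVert_J$. A bounded operator $U$ on a separable Banach space $Y$ is hypercyclic if there is $y \in Y$ whose orbit $\{U^n y : n \ge 0\}$ is dense in $Y$. *)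

theory Defs
  imports "HOL-Analysis.Analysis" "HOL-Algebra.QuotRing"
begin

section \<open>Complex Banach spaces\<close>

text \<open>
  A complex normed space is a real one with a compatible complex scalar multiplication.
  The type \<open>'a \<Rightarrow>\<^sub>L 'b\<close> contains the bounded \<^emph>\<open>real\<close>-linear maps, so
  complex linearity is imposed separately, in \<open>bounded_ops\<close> below.
\<close>

class complex_normed_vector = real_normed_vector +
  fixes scaleC :: "complex \<Rightarrow> 'a \<Rightarrow> 'a" (infixr \<open>*\<^sub>C\<close> 75)
  assumes scaleC_add_right: "c *\<^sub>C (x + y) = c *\<^sub>C x + c *\<^sub>C y"
    and scaleC_add_left: "(c + d) *\<^sub>C x = c *\<^sub>C x + d *\<^sub>C x"
    and scaleC_scaleC: "c *\<^sub>C d *\<^sub>C x = (c * d) *\<^sub>C x"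
    and scaleC_of_real: "complex_of_real r *\<^sub>C x = r *\<^sub>R x"
    and norm_scaleC: "norm (c *\<^sub>C x) = cmod c * norm x"

class complex_banach = complex_normed_vector + banach

instantiation complex :: complex_banach
begin

definition scaleC_complex :: "complex \<Rightarrow> complex \<Rightarrow> complex" where
  "scaleC_complex c z = c * z"

instance
  by standard (simp_all add: scaleC_complex_def algebra_simps norm_mult scaleR_conv_of_real)

end

lemma bounded_linear_scaleC_right: "bounded_linear (\<lambda>x. c *\<^sub>C (x :: 'a::complex_normed_vector))"
proof (rule bounded_linear_intro)
  show "c *\<^sub>C (r *\<^sub>R x) = r *\<^sub>R (c *\<^sub>C x)" for r and x :: 'a
    by (simp add: scaleC_of_real[symmetric] scaleC_scaleC mult.commute)
  show "norm (c *\<^sub>C x) \<le> norm x * cmod c" for x :: 'a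
    by (simp add: norm_scaleC mult.commute)
qed (simp add: scaleC_add_right)

lemma bounded_linear_scaleC_left: "bounded_linear (\<lambda>c. c *\<^sub>C (x :: 'a::complex_normed_vector))"
proof (rule bounded_linear_intro)
  show "(r *\<^sub>R c) *\<^sub>C x = r *\<^sub>R (c *\<^sub>C x)" for r and c :: complex
    by (simp add: scaleC_of_real[symmetric, where 'a='a] scaleC_scaleC scaleR_conv_of_real)
  show "norm (c *\<^sub>C x) \<le> cmod c * norm x" for c
    by (simp add: norm_scaleC)
qed (simp add: scaleC_add_left)

instantiation blinfun :: (real_normed_vector, complex_normed_vector) complex_normed_vector
begin

lift_definition scaleC_blinfun :: "complex \<Rightarrow> ('a \<Rightarrow>\<^sub>L 'b) \<Rightarrow> 'a \<Rightarrow>\<^sub>L 'b" is "\<lambda>c T x. c *\<^sub>C T x"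
  by (rule bounded_linear_compose[OF bounded_linear_scaleC_right])

instance
proof
  fix c d :: complex and r :: real and S T :: "'a \<Rightarrow>\<^sub>L 'b"
  show "c *\<^sub>C (S + T) = c *\<^sub>C S + c *\<^sub>C T" by transfer (simp add: scaleC_add_right)
  show "(c + d) *\<^sub>C T = c *\<^sub>C T + d *\<^sub>C T" by transfer (simp add: scaleC_add_left)
  show "c *\<^sub>C d *\<^sub>C T = (c * d) *\<^sub>C T" by transfer (simp add: scaleC_scaleC)
  show "complex_of_real r *\<^sub>C T = r *\<^sub>R T" by transfer (simp add: scaleC_of_real)
  have le: "norm (e *\<^sub>C U) \<le> cmod e * norm U" for e and U :: "'a \<Rightarrow>\<^sub>L 'b"
    by (rule norm_blinfun_bound)
      (simp_all add: scaleC_blinfun.rep_eq norm_scaleC mult.assoc mult_left_mono norm_blinfun)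
  show "norm (c *\<^sub>C T) = cmod c * norm T"
  proof (cases "c = 0")
    case True
    then show ?thesis using le[of c T] by simp
  next
    case False
    have "T = inverse c *\<^sub>C c *\<^sub>C T"
      using False by transfer (simp add: scaleC_scaleC scaleC_of_real[of 1, simplified])
    then have "norm T \<le> cmod (inverse c) * norm (c *\<^sub>C T)"
      using le[of "inverse c" "c *\<^sub>C T"] by simp
    then have "cmod c * norm T \<le> norm (c *\<^sub>C T)"
      using False by (simp add: norm_inverse norm_divide field_simps)
    then show ?thesis using le[of c T] by simp
  qed
qed

end

instance blinfun :: (real_normed_vector, complex_banach) complex_banach ..


section \<open>Bounded and compact operators\<close>

definition bounded_ops :: "('a::complex_normed_vector \<Rightarrow>\<^sub>L 'b::complex_normed_vector) set" where
  "bounded_ops = {T :: 'a \<Rightarrow>\<^sub>L 'b. \<forall>c x. T (c *\<^sub>C x) = c *\<^sub>C T x}"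

definition compact_ops :: "('a::complex_normed_vector \<Rightarrow>\<^sub>L 'b::complex_normed_vector) set" where
  "compact_ops = {T \<in> bounded_ops. compact (closure (blinfun_apply T ` cball 0 1))}"

lift_definition rank_one ::
  "('a::complex_normed_vector \<Rightarrow>\<^sub>L complex) \<Rightarrow> 'b::complex_normed_vector \<Rightarrow> 'a \<Rightarrow>\<^sub>L 'b"
  is "\<lambda>f x z. f z *\<^sub>C x"
  by (rule bounded_linear_compose[OF bounded_linear_scaleC_left])


section \<open>The Calkin algebra and Riesz operators\<close>

definition op_ring :: "('a::complex_banach \<Rightarrow>\<^sub>L 'a) ring" where
  "op_ring = \<lparr>carrier = bounded_ops, mult = (o\<^sub>L), one = id_blinfun, zero = 0, add = (+)\<rparr>"

definition calkin :: "('a::complex_banach \<Rightarrow>\<^sub>L 'a) set ring" where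
  "calkin = op_ring Quot compact_ops"

definition calkin_class :: "('a::complex_banach \<Rightarrow>\<^sub>L 'a) \<Rightarrow> ('a \<Rightarrow>\<^sub>L 'a) set" where
  "calkin_class T = compact_ops +>\<^bsub>op_ring\<^esub> T"

definition essential_spectrum :: "('a::complex_banach \<Rightarrow>\<^sub>L 'a) \<Rightarrow> complex set" where
  "essential_spectrum T = {c. calkin_class (c *\<^sub>C id_blinfun - T) \<notin> Units calkin}"

definition riesz_operator :: "('a::complex_banach \<Rightarrow>\<^sub>L 'a) \<Rightarrow> bool" where
  "riesz_operator T \<longleftrightarrow> T \<in> bounded_ops \<and> essential_spectrum T = {0}"

text \<open>The quotient above is meaningful: the compact operators form an ideal.\<close>

lemma scaleC_minus_right: "c *\<^sub>C (- x) = - (c *\<^sub>C (x :: 'a::complex_normed_vector))"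
  by (rule linear_neg[OF bounded_linear.linear[OF bounded_linear_scaleC_right]])

lemma scaleC_zero_right: "c *\<^sub>C (0 :: 'a::complex_normed_vector) = 0"
  by (rule linear_0[OF bounded_linear.linear[OF bounded_linear_scaleC_right]])

lemma ring_op_ring: "ring (op_ring :: ('a::complex_banach \<Rightarrow>\<^sub>L 'a) ring)"
proof (rule ringI)
  show "abelian_group (op_ring :: ('a \<Rightarrow>\<^sub>L 'a) ring)"
  proof (rule abelian_groupI)
    fix T :: "'a \<Rightarrow>\<^sub>L 'a"
    assume "T \<in> carrier op_ring"
    then show "\<exists>S\<in>carrier op_ring. S \<oplus>\<^bsub>op_ring\<^esub> T = \<zero>\<^bsub>op_ring\<^esub>"
      by (intro bexI[of _ "- T"])
        (auto simp: op_ring_def bounded_ops_def blinfun.minus_left scaleC_minus_right)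
  qed (auto simp: op_ring_def bounded_ops_def blinfun.add_left scaleC_add_right scaleC_zero_right)
  show "monoid (op_ring :: ('a \<Rightarrow>\<^sub>L 'a) ring)"
    by (rule monoidI) (auto simp: op_ring_def bounded_ops_def intro!: blinfun_eqI)
qed (auto simp: op_ring_def blinfun.add_left blinfun.add_right intro!: blinfun_eqI)

lemma compact_opsI:
  assumes "T \<in> bounded_ops" "compact K" "blinfun_apply T ` cball 0 1 \<subseteq> K"
  shows "T \<in> compact_ops"
proof -
  have "closure (blinfun_apply T ` cball 0 1) \<subseteq> K"
    by (rule closure_minimal[OF assms(3) compact_imp_closed[OF assms(2)]])
  then have "compact (closure (blinfun_apply T ` cball 0 1))"
    using compact_Int_closed[OF assms(2) closed_closure, of "blinfun_apply T ` cball 0 1"]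
    by (simp add: inf.absorb2)
  then show ?thesis using assms(1) by (simp add: compact_ops_def)
qed

lemma compact_ops_compose_left:
  fixes T :: "'a::complex_normed_vector \<Rightarrow>\<^sub>L 'b::complex_normed_vector" and S :: "'b \<Rightarrow>\<^sub>L 'c::complex_normed_vector"
  assumes T: "T \<in> compact_ops" and S: "S \<in> bounded_ops"
  shows "S o\<^sub>L T \<in> compact_ops"
proof (rule compact_opsI)
  show "compact (blinfun_apply S ` closure (blinfun_apply T ` cball 0 1))"
    using T by (auto simp: compact_ops_def intro!: compact_continuous_image
        linear_continuous_on blinfun.bounded_linear_right)
  show "blinfun_apply (S o\<^sub>L T) ` cball 0 1 \<subseteq> blinfun_apply S ` closure (blinfun_apply T ` cball 0 1)"
  proof clarify
    fix x :: 'a assume x: "x \<in> cball 0 1"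
    have "T x \<in> closure (blinfun_apply T ` cball 0 1)"
      using x by (intro subsetD[OF closure_subset] imageI)
    then show "(S o\<^sub>L T) x \<in> blinfun_apply S ` closure (blinfun_apply T ` cball 0 1)"
      by simp
  qed
qed (use T S in \<open>auto simp: compact_ops_def bounded_ops_def\<close>)

lemma compact_ops_compose_right:
  fixes T :: "'a::complex_normed_vector \<Rightarrow>\<^sub>L 'b::complex_normed_vector" and S :: "'c::complex_normed_vector \<Rightarrow>\<^sub>L 'a"
  assumes T: "T \<in> compact_ops" and S: "S \<in> bounded_ops"
  shows "T o\<^sub>L S \<in> compact_ops"
proof (rule compact_opsI)
  define r where "r = norm S + 1"
  have r: "r > 0" by (simp add: r_def add_nonneg_pos)
  show "compact ((*\<^sub>R) r ` closure (blinfun_apply T ` cball 0 1))"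
    using T by (auto simp: compact_ops_def intro!: compact_scaling)
  show "blinfun_apply (T o\<^sub>L S) ` cball 0 1 \<subseteq> (*\<^sub>R) r ` closure (blinfun_apply T ` cball 0 1)"
  proof clarify
    fix x :: 'c assume "x \<in> cball 0 1"
    then have "norm S * norm x \<le> norm S * 1"
      by (intro mult_left_mono) auto
    then have "norm (S x) \<le> r"
      using norm_blinfun[of S x] by (simp add: r_def)
    then have "inverse r *\<^sub>R S x \<in> cball 0 1"
      using r by (simp add: field_simps)
    then have "T (inverse r *\<^sub>R S x) \<in> closure (blinfun_apply T ` cball 0 1)"
      by (intro subsetD[OF closure_subset] imageI)
    moreover have "(T o\<^sub>L S) x = r *\<^sub>R T (inverse r *\<^sub>R S x)"
      using r by (simp add: blinfun.scaleR_right)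
    ultimately show "(T o\<^sub>L S) x \<in> (*\<^sub>R) r ` closure (blinfun_apply T ` cball 0 1)"
      by (rule rev_image_eqI)
  qed
qed (use T S in \<open>auto simp: compact_ops_def bounded_ops_def\<close>)

lemma compact_ops_add:
  fixes S T :: "'a::complex_normed_vector \<Rightarrow>\<^sub>L 'b::complex_normed_vector"
  assumes S: "S \<in> compact_ops" and T: "T \<in> compact_ops"
  shows "S + T \<in> compact_ops"
proof (rule compact_opsI)
  let ?K = "\<lambda>T. closure (blinfun_apply T ` cball 0 1)"
  show "compact {x + y |x y. x \<in> ?K S \<and> y \<in> ?K T}"
    using S T by (auto simp: compact_ops_def intro!: compact_sums)
  show "blinfun_apply (S + T) ` cball 0 1 \<subseteq> {x + y |x y. x \<in> ?K S \<and> y \<in> ?K T}"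
  proof (intro image_subsetI CollectI exI conjI)
    fix x :: 'a assume x: "x \<in> cball 0 1"
    show "(S + T) x = S x + T x" by (rule blinfun.add_left)
    show "S x \<in> ?K S" "T x \<in> ?K T"
      using x by (intro subsetD[OF closure_subset] imageI; assumption)+
  qed
qed (use T S in \<open>auto simp: compact_ops_def bounded_ops_def blinfun.add_left scaleC_add_right\<close>)

lemma ideal_compact_ops: "ideal compact_ops (op_ring :: ('a::complex_banach \<Rightarrow>\<^sub>L 'a) ring)"
proof (rule idealI)
  show "ring (op_ring :: ('a \<Rightarrow>\<^sub>L 'a) ring)" by (rule ring_op_ring)
  show "subgroup compact_ops (add_monoid (op_ring :: ('a \<Rightarrow>\<^sub>L 'a) ring))"
  proof (rule subgroup.intro)
    show "\<one>\<^bsub>add_monoid op_ring\<^esub> \<in> (compact_ops :: ('a \<Rightarrow>\<^sub>L 'a) set)"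
      using compact_opsI[of "0 :: 'a \<Rightarrow>\<^sub>L 'a" "{0}"]
      by (auto simp: op_ring_def bounded_ops_def scaleC_zero_right)
  next
    fix T :: "'a \<Rightarrow>\<^sub>L 'a"
    assume T: "T \<in> compact_ops"
    have m: "- id_blinfun \<in> (bounded_ops :: ('a \<Rightarrow>\<^sub>L 'a) set)"
      by (simp add: bounded_ops_def blinfun.minus_left scaleC_minus_right)
    have "- T = - id_blinfun o\<^sub>L T"
      by (rule blinfun_eqI) (simp add: blinfun.minus_left)
    then have n: "- T \<in> compact_ops"
      using compact_ops_compose_left[OF T m] by simp
    have "\<ominus>\<^bsub>op_ring\<^esub> T = - T"
      using T n by (intro abelian_group.minus_equality[OF ring.is_abelian_group[OF ring_op_ring]])
        (auto simp: op_ring_def compact_ops_def)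
    then show "inv\<^bsub>add_monoid op_ring\<^esub> T \<in> compact_ops"
      using n by (simp add: a_inv_def)
  qed (use compact_ops_add in \<open>auto simp: op_ring_def compact_ops_def\<close>)
qed (simp_all add: op_ring_def compact_ops_compose_left compact_ops_compose_right)


section \<open>Banach ideals\<close>

text \<open>The norm \<open>N\<close> of the ideal is a function on all operators; only its values on \<open>J\<close> matter.\<close>

locale banach_ideal =
  fixes J :: "('a::complex_banach \<Rightarrow>\<^sub>L 'a) set" and N :: "('a \<Rightarrow>\<^sub>L 'a) \<Rightarrow> real"
  assumes subset_bounded_ops: "J \<subseteq> bounded_ops"
    and zero_mem: "0 \<in> J"
    and add_mem: "\<lbrakk>S \<in> J; T \<in> J\<rbrakk> \<Longrightarrow> S + T \<in> J"
    and scaleC_mem: "S \<in> J \<Longrightarrow> c *\<^sub>C S \<in> J"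
    and N_eq_0_iff: "S \<in> J \<Longrightarrow> N S = 0 \<longleftrightarrow> S = 0"
    and N_triangle: "\<lbrakk>S \<in> J; T \<in> J\<rbrakk> \<Longrightarrow> N (S + T) \<le> N S + N T"
    and N_scaleC: "S \<in> J \<Longrightarrow> N (c *\<^sub>C S) = cmod c * N S"
    and N_complete: "\<lbrakk>\<And>n. X n \<in> J; \<And>e. e > 0 \<Longrightarrow> \<exists>M. \<forall>m\<ge>M. \<forall>n\<ge>M. N (X m - X n) < e\<rbrakk>
          \<Longrightarrow> \<exists>S\<in>J. (\<lambda>n. N (X n - S)) \<longlonglongrightarrow> 0"
    and norm_le_N: "S \<in> J \<Longrightarrow> norm S \<le> N S"
    and comp_mem: "\<lbrakk>A \<in> bounded_ops; B \<in> bounded_ops; S \<in> J\<rbrakk> \<Longrightarrow> B o\<^sub>L S o\<^sub>L A \<in> J"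
    and N_comp: "\<lbrakk>A \<in> bounded_ops; B \<in> bounded_ops; S \<in> J\<rbrakk>
          \<Longrightarrow> N (B o\<^sub>L S o\<^sub>L A) \<le> norm B * norm A * N S"
    and rank_one_mem: "f \<in> bounded_ops \<Longrightarrow> rank_one f x \<in> J"
    and N_rank_one: "f \<in> bounded_ops \<Longrightarrow> N (rank_one f x) = norm f * norm x"


section \<open>Hypercyclic operators\<close>

text \<open>
  In the following, \<open>V\<close> is a subspace carrying the norm \<open>N\<close>, and density is with respect to
  that norm, not to the norm of the ambient type.
\<close>

definition dense_wrt :: "'v::ab_group_add set \<Rightarrow> ('v \<Rightarrow> real) \<Rightarrow> 'v set \<Rightarrow> bool" where
  "dense_wrt V N D \<longleftrightarrow> D \<subseteq> V \<and> (\<forall>v\<in>V. \<forall>e>0. \<exists>d\<in>D. N (v - d) < e)"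

definition separable_wrt :: "'v::ab_group_add set \<Rightarrow> ('v \<Rightarrow> real) \<Rightarrow> bool" where
  "separable_wrt V N \<longleftrightarrow> (\<exists>D. countable D \<and> dense_wrt V N D)"

definition hypercyclic_on :: "'v::ab_group_add set \<Rightarrow> ('v \<Rightarrow> real) \<Rightarrow> ('v \<Rightarrow> 'v) \<Rightarrow> bool" where
  "hypercyclic_on V N U \<longleftrightarrow> (\<exists>y\<in>V. dense_wrt V N (range (\<lambda>n. (U ^^ n) y)))"

definition gen_derivation ::
  "('a::real_normed_vector \<Rightarrow>\<^sub>L 'a) \<Rightarrow> ('a \<Rightarrow>\<^sub>L 'a) \<Rightarrow> ('a \<Rightarrow>\<^sub>L 'a) \<Rightarrow> ('a \<Rightarrow>\<^sub>L 'a)" where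
  "gen_derivation A B T = (A o\<^sub>L T) - (T o\<^sub>L B)"

end

theory Submission
  imports Defs
begin

text \<open>
  Write \<open>\<tau>\<close> for \<open>gen_derivation A B\<close>. The obstruction to hypercyclicity is a nonzero operator \<open>P\<close>
  and a nonzero vector \<open>q\<close> such that \<open>\<parallel>P A\<^sup>n\<parallel>\<close> and \<open>\<parallel>B\<^sup>n q\<parallel>\<close> are both \<open>O(2\<^sup>-\<^sup>n)\<close>. Expanding \<open>\<tau>\<^sup>n T\<close>
  gives \<open>2\<^sup>n\<close> terms of the form \<open>\<plusminus> A\<^sup>j T B\<^sup>k\<close> with \<open>j + k = n\<close>, so \<open>P (\<tau>\<^sup>n T) q\<close> stays bounded in \<open>n\<close>
  (\<open>derivation_orbit_bound\<close>). If the orbit of \<open>T\<close> were dense in \<open>J\<close>, the linear map \<open>S \<mapsto> P S q\<close>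
  would be bounded on all of the vector space \<open>J\<close>, hence zero; but a rank one operator \<open>S\<close> can send
  \<open>q\<close> to any vector, in particular to one on which \<open>P\<close> does not vanish. The functional that
  such a rank one operator needs comes from the Hahn-Banach theorem, proved here in the form
  \<open>exists_complex_functional\<close>.

  For the existence of \<open>P\<close> and \<open>q\<close> let \<open>A\<close> be a Riesz operator and suppose that the circle
  \<open>\<bar>z\<bar> = r\<close>, \<open>r < 1/2\<close>, avoids the spectrum of \<open>A\<close>. The Riesz projection
  \<open>P = \<integral> z (z - A)\<^sup>-\<^sup>1 dt\<close> (\<open>z = r e\<^sup>i\<^sup>t\<close>, up to the factor \<open>2\<pi>\<close>) satisfies
  \<open>A\<^sup>n P = P A\<^sup>n = \<integral> z\<^sup>n\<^sup>+\<^sup>1 (z - A)\<^sup>-\<^sup>1 dt\<close>, which is \<open>O(r\<^sup>n)\<close>; and \<open>P = 0\<close> would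
  produce an inverse of \<open>A\<close>, although \<open>0\<close> lies in the essential spectrum
  (\<open>operator_decaying_along_powers\<close>). For \<open>q\<close> take a vector in the range of the operator so obtained from \<open>B\<close>.

  The circle exists because the spectrum cannot accumulate away from \<open>0\<close> (\<open>resolvent_circle\<close>).
  At \<open>z \<noteq> 0\<close> the operator \<open>z - A\<close> has a left inverse \<open>S\<close> modulo compact operators. If \<open>z\<close> is on the
  frontier of the spectrum, then \<open>z - A\<close> is not bounded below, and \<open>S\<close> turns approximate
  eigenvectors into an eigenvector. Moreover the resolvent \<open>V = (w - A)\<^sup>-\<^sup>1\<close> at a point \<open>w\<close> close to \<open>z\<close>
  is a compact operator plus one of norm comparable with \<open>\<parallel>S\<parallel>\<close>, uniformly in \<open>w\<close>, whereas an
  eigenvalue \<open>v\<close> of \<open>A\<close> close to \<open>z\<close> gives the huge eigenvalue \<open>1 / (w - v)\<close> of \<open>V\<close>; a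
  Riesz lemma argument allows only finitely many of these. So the
  frontier has no limit point other than \<open>0\<close>, only finitely many frontier points lie outside a disc
  around \<open>0\<close>, and connectedness excludes every other spectral point there.
\<close>

section \<open>Invertibility and the spectrum\<close>

text \<open>
  The inverse is only asked to be bounded and real-linear; for a complex-linear operator it is
  automatically complex-linear, see \<open>inverse_mem_bounded_ops\<close> below.
\<close>

definition blinfun_invertible :: "('a::real_normed_vector \<Rightarrow>\<^sub>L 'a) \<Rightarrow> bool" where
  "blinfun_invertible T \<longleftrightarrow> (\<exists>V. V o\<^sub>L T = id_blinfun \<and> T o\<^sub>L V = id_blinfun)"

definition op_spectrum :: "('a::complex_normed_vector \<Rightarrow>\<^sub>L 'a) \<Rightarrow> complex set" where
  "op_spectrum T = {z. \<not> blinfun_invertible (z *\<^sub>C id_blinfun - T)}"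

lemma scaleC_one: "1 *\<^sub>C x = (x :: 'a::complex_normed_vector)"
  using scaleC_of_real[of 1 x] by simp

lemma scaleC_zero_left: "0 *\<^sub>C x = (0 :: 'a::complex_normed_vector)"
  using scaleC_of_real[of 0 x] by simp

lemma scaleC_minus_left: "(- c) *\<^sub>C x = - (c *\<^sub>C (x :: 'a::complex_normed_vector))"
  by (rule linear_neg[OF bounded_linear.linear[OF bounded_linear_scaleC_left]])

lemma scaleC_diff_left: "(c - d) *\<^sub>C x = c *\<^sub>C x - d *\<^sub>C (x :: 'a::complex_normed_vector)"
  by (rule linear_diff[OF bounded_linear.linear[OF bounded_linear_scaleC_left]])

lemma scaleC_diff_right: "c *\<^sub>C (x - y) = c *\<^sub>C x - c *\<^sub>C (y :: 'a::complex_normed_vector)"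
  by (rule linear_diff[OF bounded_linear.linear[OF bounded_linear_scaleC_right]])

lemmas compose_diff_left = bounded_bilinear.diff_left[OF bounded_bilinear_blinfun_compose]
lemmas compose_diff_right = bounded_bilinear.diff_right[OF bounded_bilinear_blinfun_compose]

lemma compose_assoc: "(S o\<^sub>L T) o\<^sub>L U = S o\<^sub>L (T o\<^sub>L U)"
  by (rule blinfun_eqI) simp

lemma compose_id [simp]: "T o\<^sub>L id_blinfun = T" "id_blinfun o\<^sub>L T = T"
  by (rule blinfun_eqI, simp)+

lemma scaleC_scaleR: "c *\<^sub>C (r *\<^sub>R x) = r *\<^sub>R (c *\<^sub>C (x :: 'a::complex_normed_vector))"
  by (rule linear_scale[OF bounded_linear.linear[OF bounded_linear_scaleC_right]])

lemma compose_eqD: "S o\<^sub>L T = U \<Longrightarrow> S (T x) = U x"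
  by (simp flip: blinfun_apply_blinfun_compose)

lemma bounded_opsD: "T \<in> bounded_ops \<Longrightarrow> T (c *\<^sub>C x) = c *\<^sub>C T x"
  by (simp add: bounded_ops_def)

lemma shifted_mem_bounded_ops:
  "T \<in> bounded_ops \<Longrightarrow> z *\<^sub>C id_blinfun - T \<in> bounded_ops"
  by (simp add: bounded_ops_def blinfun.diff_left scaleC_blinfun.rep_eq scaleC_diff_right
      scaleC_scaleC mult.commute)

lemma shifted_apply: "(z *\<^sub>C id_blinfun - T) x = z *\<^sub>C x - blinfun_apply T x"
  by (simp add: blinfun.diff_left scaleC_blinfun.rep_eq)

lemma inverse_mem_bounded_ops:
  assumes T: "T \<in> bounded_ops" and VT: "V o\<^sub>L T = id_blinfun" and TV: "T o\<^sub>L V = id_blinfun"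
  shows "V \<in> bounded_ops"
  unfolding bounded_ops_def
proof (intro CollectI allI)
  fix c x
  have "T (V x) = x" for x
    using compose_eqD[OF TV, of x] by simp
  moreover have "V (T x) = x" for x
    using compose_eqD[OF VT, of x] by simp
  ultimately show "V (c *\<^sub>C x) = c *\<^sub>C V x"
    using bounded_opsD[OF T, of c "V x"] by metis
qed

text \<open>
  Instead of summing the Neumann series, solve \<open>V = 1 + T V\<close> and \<open>W = 1 + W T\<close> with the contraction
  principle in the Banach space of operators; a right inverse and a left inverse coincide.
\<close>

lemma id_minus_invertible:
  fixes T :: "'a::banach \<Rightarrow>\<^sub>L 'a"
  assumes "norm T < 1"
  shows "blinfun_invertible (id_blinfun - T)"
proof -
  have "\<exists>!V. id_blinfun + (T o\<^sub>L V) = V"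
  proof (rule banach_fix_type[of "norm T"])
    show "\<forall>V W. dist (id_blinfun + (T o\<^sub>L V)) (id_blinfun + (T o\<^sub>L W)) \<le> norm T * dist V W"
      using norm_blinfun_compose[of T] by (auto simp: dist_norm simp flip: compose_diff_right)
  qed (use assms in auto)
  then obtain V where V: "id_blinfun + (T o\<^sub>L V) = V" by blast
  have "\<exists>!W. id_blinfun + (W o\<^sub>L T) = W"
  proof (rule banach_fix_type[of "norm T"])
    show "\<forall>V W. dist (id_blinfun + (V o\<^sub>L T)) (id_blinfun + (W o\<^sub>L T)) \<le> norm T * dist V W"
      using norm_blinfun_compose[of _ T]
      by (auto simp: dist_norm mult.commute[of "norm T"] simp flip: compose_diff_left)
  qed (use assms in auto)
  then obtain W where W: "id_blinfun + (W o\<^sub>L T) = W" by blast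
  have 1: "(id_blinfun - T) o\<^sub>L V = id_blinfun" and 2: "W o\<^sub>L (id_blinfun - T) = id_blinfun"
    using V W by (simp_all add: compose_diff_left compose_diff_right algebra_simps)
  have "W = W o\<^sub>L ((id_blinfun - T) o\<^sub>L V)" by (simp add: 1)
  also have "\<dots> = V" by (simp only: compose_assoc[symmetric] 2) simp
  finally show ?thesis using 1 2 by (auto simp: blinfun_invertible_def)
qed

lemma invertible_compose:
  assumes "blinfun_invertible S" "blinfun_invertible T"
  shows "blinfun_invertible (S o\<^sub>L T)"
proof -
  obtain V W where V: "V o\<^sub>L S = id_blinfun" "S o\<^sub>L V = id_blinfun"
    and W: "W o\<^sub>L T = id_blinfun" "T o\<^sub>L W = id_blinfun"
    using assms by (auto simp: blinfun_invertible_def)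
  have "(W o\<^sub>L V) o\<^sub>L (S o\<^sub>L T) = W o\<^sub>L (V o\<^sub>L S) o\<^sub>L T"
    "(S o\<^sub>L T) o\<^sub>L (W o\<^sub>L V) = S o\<^sub>L (T o\<^sub>L W) o\<^sub>L V"
    by (simp_all add: compose_assoc)
  then show ?thesis
    using V W unfolding blinfun_invertible_def by (intro exI[of _ "W o\<^sub>L V"]) simp
qed

lemma invertible_perturb:
  fixes T :: "'a::banach \<Rightarrow>\<^sub>L 'a"
  assumes VT: "V o\<^sub>L T = id_blinfun" and TV: "T o\<^sub>L V = id_blinfun" and less: "norm V * norm E < 1"
  shows "blinfun_invertible (T - E)"
proof -
  have "norm (V o\<^sub>L E) < 1"
    using norm_blinfun_compose[of V E] less by simp
  then have "blinfun_invertible (id_blinfun - (V o\<^sub>L E))" by (rule id_minus_invertible)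
  moreover have "blinfun_invertible T" using VT TV by (auto simp: blinfun_invertible_def)
  ultimately have "blinfun_invertible (T o\<^sub>L (id_blinfun - (V o\<^sub>L E)))"
    by (intro invertible_compose)
  then show ?thesis
    by (simp add: compose_diff_right compose_assoc[symmetric] TV)
qed

lemma norm_scaleC_id: "norm (z *\<^sub>C (id_blinfun :: 'a::complex_normed_vector \<Rightarrow>\<^sub>L 'a)) \<le> cmod z"
  by (simp add: norm_scaleC mult_left_le norm_blinfun_id_le)

lemma shift_notin_op_spectrum:
  fixes A :: "'a::complex_banach \<Rightarrow>\<^sub>L 'a"
  assumes V: "V o\<^sub>L (z *\<^sub>C id_blinfun - A) = id_blinfun" "(z *\<^sub>C id_blinfun - A) o\<^sub>L V = id_blinfun"
    and less: "norm V * cmod (z - w) < 1"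
  shows "w \<notin> op_spectrum A"
proof -
  have "norm V * norm ((z - w) *\<^sub>C id_blinfun :: 'a \<Rightarrow>\<^sub>L 'a) \<le> norm V * cmod (z - w)"
    by (intro mult_left_mono norm_scaleC_id) simp
  then have "blinfun_invertible (z *\<^sub>C id_blinfun - A - (z - w) *\<^sub>C id_blinfun)"
    using less by (intro invertible_perturb[OF V]) simp
  then show ?thesis by (simp add: op_spectrum_def scaleC_diff_left algebra_simps)
qed

lemma closed_op_spectrum: "closed (op_spectrum (A :: 'a::complex_banach \<Rightarrow>\<^sub>L 'a))"
proof -
  have "open (- op_spectrum A)"
    unfolding open_contains_ball
  proof
    fix z assume "z \<in> - op_spectrum A"
    then obtain V where V: "V o\<^sub>L (z *\<^sub>C id_blinfun - A) = id_blinfun"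
        "(z *\<^sub>C id_blinfun - A) o\<^sub>L V = id_blinfun"
      by (auto simp: op_spectrum_def blinfun_invertible_def)
    have "ball z (1 / (norm V + 1)) \<subseteq> - op_spectrum A"
    proof
      fix w assume "w \<in> ball z (1 / (norm V + 1))"
      then have "(norm V + 1) * cmod (z - w) < 1"
        by (simp add: dist_norm pos_less_divide_eq add_nonneg_pos mult.commute)
      then have "norm V * cmod (z - w) < 1"
        using norm_ge_zero[of "z - w"] by (simp add: distrib_right del: norm_ge_zero)
      then show "w \<in> - op_spectrum A" using shift_notin_op_spectrum[OF V] by simp
    qed
    then show "\<exists>e>0. ball z e \<subseteq> - op_spectrum A"
      by (intro exI[of _ "1 / (norm V + 1)"]) (simp add: add_nonneg_pos)
  qed
  then show ?thesis by (simp add: closed_def)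
qed

lemma op_spectrum_norm_le:
  fixes A :: "'a::complex_banach \<Rightarrow>\<^sub>L 'a"
  assumes "z \<in> op_spectrum A"
  shows "cmod z \<le> norm A"
proof (rule ccontr)
  assume *: "\<not> cmod z \<le> norm A"
  then have z: "z \<noteq> 0" by auto
  let ?I = "id_blinfun :: 'a \<Rightarrow>\<^sub>L 'a"
  have "(inverse z *\<^sub>C ?I) o\<^sub>L (z *\<^sub>C ?I) = ?I" "(z *\<^sub>C ?I) o\<^sub>L (inverse z *\<^sub>C ?I) = ?I"
    using z by (auto intro!: blinfun_eqI simp: scaleC_blinfun.rep_eq scaleC_scaleC scaleC_one)
  moreover have "norm (inverse z *\<^sub>C ?I) * norm A < 1"
  proof -
    have "norm (inverse z *\<^sub>C ?I) * norm A \<le> cmod (inverse z) * norm A"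
      by (intro mult_right_mono norm_scaleC_id) simp
    also have "\<dots> = norm A / cmod z" by (simp add: norm_inverse divide_inverse mult.commute)
    also have "\<dots> < 1" using * z by simp
    finally show ?thesis .
  qed
  ultimately have "blinfun_invertible (z *\<^sub>C ?I - A)" by (rule invertible_perturb)
  then show False using assms by (simp add: op_spectrum_def)
qed

text \<open>
  If \<open>z - A\<close> were bounded below by \<open>e\<close>, the resolvent would be bounded by about \<open>1 / e\<close> at all
  points near \<open>z\<close> where it is defined. Since \<open>z\<close> is a frontier point there are such
  points \<open>w\<close> with \<open>\<bar>w - z\<bar> \<parallel>(w - A)\<^sup>-\<^sup>1\<parallel> < 1\<close>, and then \<open>z - A\<close>, a small perturbation of \<open>w - A\<close>, would be
  invertible too.
\<close>

lemma frontier_op_spectrum_not_bounded_below: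
  fixes A :: "'a::complex_banach \<Rightarrow>\<^sub>L 'a"
  assumes z: "z \<in> frontier (op_spectrum A)" and e: "e > 0"
  obtains x where "norm x = 1" "norm (z *\<^sub>C x - A x) < e"
proof -
  have zs: "z \<in> op_spectrum A" using z closed_op_spectrum frontier_subset_closed by blast
  obtain w where w: "w \<notin> op_spectrum A" "dist z w < e / 3"
    using z e unfolding frontier_straddle by (auto dest!: spec[of _ "e / 3"])
  then obtain V where V: "V o\<^sub>L (w *\<^sub>C id_blinfun - A) = id_blinfun"
      "(w *\<^sub>C id_blinfun - A) o\<^sub>L V = id_blinfun"
    by (auto simp: op_spectrum_def blinfun_invertible_def)
  have V': "w *\<^sub>C V y - A (V y) = y" for y
    using compose_eqD[OF V(2), of y] by (simp add: shifted_apply)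
  \<comment> \<open>With \<open>w\<close> at distance at most \<open>e / 3\<close>, the lower bound at \<open>w\<close> is \<open>2 e / 3\<close>, so \<open>\<parallel>V\<parallel> \<bar>w - z\<bar> \<le> 1/2\<close>.\<close>
  have "\<exists>x. x \<noteq> 0 \<and> norm (z *\<^sub>C x - A x) < e * norm x"
  proof (rule ccontr)
    assume "\<not> ?thesis"
    then have lower: "e * norm x \<le> norm (z *\<^sub>C x - A x)" for x
      by (cases "x = 0") (auto simp: not_less)
    have "norm (V y) \<le> (3 / (2 * e)) * norm y" for y
    proof -
      have "e * norm (V y) \<le> norm (w *\<^sub>C V y - A (V y) + (z - w) *\<^sub>C V y)"
        using lower[of "V y"] by (simp add: scaleC_diff_left)
      also have "\<dots> \<le> norm y + cmod (z - w) * norm (V y)"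
        using norm_triangle_ineq[of y "(z - w) *\<^sub>C V y"] by (simp add: V' norm_scaleC)
      also have "cmod (z - w) * norm (V y) \<le> (e / 3) * norm (V y)"
        using w(2) by (intro mult_right_mono) (auto simp: dist_norm)
      finally show ?thesis using e by (simp add: field_simps)
    qed
    then have "norm V \<le> 3 / (2 * e)" using e by (intro norm_blinfun_bound) auto
    then have "norm V * cmod (w - z) \<le> (3 / (2 * e)) * (e / 3)"
      using w(2) e by (intro mult_mono) (auto simp: dist_norm norm_minus_commute)
    then have "norm V * cmod (w - z) < 1" using e by simp
    then show False using shift_notin_op_spectrum[OF V] zs by blast
  qed
  then obtain x where x: "x \<noteq> 0" "norm (z *\<^sub>C x - A x) < e * norm x" by blast
  have "z *\<^sub>C (inverse (norm x) *\<^sub>R x) - A (inverse (norm x) *\<^sub>R x)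
      = inverse (norm x) *\<^sub>R (z *\<^sub>C x - A x)"
    by (simp add: blinfun.scaleR_right scaleR_diff_right scaleC_scaleR)
  moreover have "inverse (norm x) * norm (z *\<^sub>C x - A x) < e"
    using mult_strict_left_mono[OF x(2), of "inverse (norm x)"] x(1) by (simp add: mult.left_commute)
  ultimately have "norm (z *\<^sub>C (inverse (norm x) *\<^sub>R x) - A (inverse (norm x) *\<^sub>R x)) < e"
    by simp
  moreover have "norm (inverse (norm x) *\<^sub>R x) = 1" using x by simp
  ultimately show ?thesis using that by blast
qed

section \<open>Eigenvalues and the frontier of the spectrum\<close>

lemma compact_ops_subsequence:
  fixes T :: "'a::complex_normed_vector \<Rightarrow>\<^sub>L 'b::complex_normed_vector"
  assumes T: "T \<in> compact_ops" and x: "\<And>n. norm (x n) \<le> 1"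
  obtains l r where "strict_mono (r :: nat \<Rightarrow> nat)" "(\<lambda>n. T (x (r n))) \<longlonglongrightarrow> l"
proof -
  have "seq_compact (closure (blinfun_apply T ` cball 0 1))"
    using T by (simp add: compact_ops_def compact_imp_seq_compact)
  moreover have "T (x n) \<in> closure (blinfun_apply T ` cball 0 1)" for n
    using x by (intro subsetD[OF closure_subset] imageI) simp
  ultimately obtain l r where "strict_mono (r :: nat \<Rightarrow> nat)" "((\<lambda>n. T (x n)) \<circ> r) \<longlonglongrightarrow> l"
    by (metis seq_compactE)
  then show ?thesis using that by (auto simp: o_def)
qed

text \<open>
  For approximate eigenvectors \<open>x\<^sub>n\<close> the identity \<open>x\<^sub>n = S ((z - A) x\<^sub>n) - K x\<^sub>n\<close> shows that a subsequence
  converges, since the first term tends to \<open>0\<close> and \<open>K\<close> is compact.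
\<close>

lemma eigenvector_of_approximate:
  fixes A :: "'a::complex_banach \<Rightarrow>\<^sub>L 'a"
  assumes S: "S o\<^sub>L (z *\<^sub>C id_blinfun - A) = id_blinfun + K" and K: "K \<in> compact_ops"
    and approx: "\<And>e. e > 0 \<Longrightarrow> \<exists>x. norm x = 1 \<and> norm (z *\<^sub>C x - A x) < e"
  obtains x where "x \<noteq> 0" "A x = z *\<^sub>C x"
proof -
  have "\<forall>n. \<exists>x. norm x = 1 \<and> norm (z *\<^sub>C x - A x) < inverse (real (Suc n))"
    by (intro allI approx) simp
  then obtain x where x: "\<And>n. norm (x n) = 1"
      "\<And>n. norm (z *\<^sub>C x n - A (x n)) < inverse (real (Suc n))"
    by metis
  obtain l r where r: "strict_mono (r :: nat \<Rightarrow> nat)" "(\<lambda>n. K (x (r n))) \<longlonglongrightarrow> l"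
    using compact_ops_subsequence[OF K, of x] x(1) by (metis order_refl)
  have "(\<lambda>n. z *\<^sub>C x n - A (x n)) \<longlonglongrightarrow> 0"
    by (rule Lim_null_comparison[OF _ LIMSEQ_inverse_real_of_nat])
      (intro always_eventually allI less_imp_le x(2))
  then have lim0: "(\<lambda>n. z *\<^sub>C x (r n) - A (x (r n))) \<longlonglongrightarrow> 0"
    using LIMSEQ_subseq_LIMSEQ[OF _ r(1)] by (auto simp: o_def)
  have "x n = S (z *\<^sub>C x n - A (x n)) - K (x n)" for n
    using compose_eqD[OF S, of "x n"] by (simp add: shifted_apply blinfun.add_left)
  moreover have "(\<lambda>n. S (z *\<^sub>C x (r n) - A (x (r n))) - K (x (r n))) \<longlonglongrightarrow> S 0 - l"
    by (intro tendsto_diff blinfun.tendsto[OF tendsto_const lim0] r(2))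
  ultimately have xl: "(\<lambda>n. x (r n)) \<longlonglongrightarrow> - l" by simp
  have "(\<lambda>n. norm (x (r n))) \<longlonglongrightarrow> norm (- l)" by (intro tendsto_norm xl)
  then have "norm (- l) = 1" by (simp add: x(1) LIMSEQ_const_iff)
  moreover have "(\<lambda>n. z *\<^sub>C x (r n) - A (x (r n))) \<longlonglongrightarrow> z *\<^sub>C (- l) - A (- l)"
    by (intro tendsto_diff bounded_linear.tendsto[OF bounded_linear_scaleC_right] xl
        blinfun.tendsto[OF tendsto_const])
  then have "z *\<^sub>C (- l) - A (- l) = 0" using lim0 LIMSEQ_unique by blast
  then have "A (- l) = z *\<^sub>C (- l)" by (simp only: right_minus_eq)
  ultimately show ?thesis using that[of "- l"] by force
qed

text \<open>
  Normalise \<open>x - w\<close>, where \<open>w\<close> is a point of \<open>M\<close> whose distance to \<open>x\<close> is within a factor \<open>2\<close> of optimal.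
\<close>

lemma riesz_lemma:
  fixes M N :: "'a::real_normed_vector set"
  assumes M: "subspace M" "closed M" and N: "subspace N" "M \<subseteq> N" and x: "x \<in> N" "x \<notin> M"
  obtains y where "y \<in> N" "norm y = 1" "\<And>v. v \<in> M \<Longrightarrow> 1 / 2 \<le> norm (y - v)"
proof -
  have M0: "M \<noteq> {}" using subspace_0[OF M(1)] by blast
  define d where "d = infdist x M"
  have d: "d > 0"
    unfolding d_def using in_closed_iff_infdist_zero[OF M(2) M0] x(2) infdist_nonneg[of x M]
    by (metis less_eq_real_def)
  have "\<exists>w\<in>M. dist x w < 2 * d"
  proof (rule ccontr)
    assume "\<not> ?thesis"
    then have "2 * d \<le> infdist x M" using M0 by (auto simp: infdist_def not_less intro!: cINF_greatest)
    then show False using d by (simp add: d_def)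
  qed
  then obtain w where w: "w \<in> M" "norm (x - w) < 2 * d" by (auto simp: dist_norm)
  define c where "c = norm (x - w)"
  have c: "c > 0" using w(1) x(2) by (auto simp: c_def)
  have "1 / 2 \<le> norm ((x - w) /\<^sub>R c - v)" if v: "v \<in> M" for v
  proof -
    have "d \<le> norm (x - (w + c *\<^sub>R v))"
      using infdist_le[of "w + c *\<^sub>R v" M x] w(1) v M(1)
      by (auto simp: d_def dist_norm intro: subspace_add subspace_scale)
    also have "x - (w + c *\<^sub>R v) = c *\<^sub>R ((x - w) /\<^sub>R c - v)"
      using c by (simp add: scaleR_diff_right)
    also have "norm \<dots> = c * norm ((x - w) /\<^sub>R c - v)" using c by simp
    finally have "c / 2 \<le> c * norm ((x - w) /\<^sub>R c - v)" using w(2) by (simp add: c_def)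
    then show ?thesis using c by simp
  qed
  moreover have "(x - w) /\<^sub>R c \<in> N"
    using N w(1) x(1) by (auto intro!: subspace_scale subspace_diff)
  moreover have "norm ((x - w) /\<^sub>R c) = 1" using c by (simp add: c_def)
  ultimately show ?thesis by (rule that[rotated 2])
qed

text \<open>
  The hypothesis on \<open>V\<close> says that it is, up to a compact term, of norm at most \<open>a\<close>. Distinct eigenvalues
  \<open>\<mu>\<^sub>0, \<mu>\<^sub>1, \<dots>\<close> give a strictly increasing chain of closed invariant subspaces
  \<open>M k = ker ((V - \<mu>\<^sub>0) \<cdots> (V - \<mu>\<^sub>k\<^sub>-\<^sub>1))\<close> such that \<open>V - \<mu>\<^sub>k\<close> maps \<open>M (k + 1)\<close> into \<open>M k\<close>. Unit
  vectors \<open>y\<^sub>k \<in> M (k + 1)\<close> at distance at least \<open>1/2\<close> from \<open>M k\<close> have images at mutual distance at least \<open>m / 2\<close>,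
  whereas along a subsequence for which \<open>C y\<^sub>k\<close> converges these distances are at most about \<open>2 a\<close>.
  Kernels are used rather than spans of eigenvectors because they are visibly closed.
\<close>

lemma finite_large_eigenvalues:
  fixes V C :: "'a::complex_banach \<Rightarrow>\<^sub>L 'a"
  assumes V: "V \<in> bounded_ops" and C: "C \<in> compact_ops" and a: "a \<ge> 0" and b: "b \<ge> 0"
    and V_le: "\<And>x. norm (V x) \<le> a * norm x + b * norm (C x)" and m: "m > 4 * a"
  shows "finite {\<mu>. m \<le> cmod \<mu> \<and> (\<exists>x. x \<noteq> 0 \<and> V x = \<mu> *\<^sub>C x)}"
proof (rule ccontr)
  define E where "E = {\<mu>. m \<le> cmod \<mu> \<and> (\<exists>x. x \<noteq> 0 \<and> V x = \<mu> *\<^sub>C x)}"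
  assume "\<not> ?thesis"
  then have "infinite E" by (simp add: E_def)
  then obtain \<mu> :: "nat \<Rightarrow> complex" where inj: "inj \<mu>" and \<mu>: "range \<mu> \<subseteq> E"
    using infinite_countable_subset by blast
  have \<mu>_ge: "m \<le> cmod (\<mu> k)" and eigen: "\<exists>x. x \<noteq> 0 \<and> V x = \<mu> k *\<^sub>C x" for k
    using subsetD[OF \<mu> rangeI, of k] by (simp_all add: E_def)
  define D where "D = rec_nat id_blinfun (\<lambda>k F. F o\<^sub>L (V - \<mu> k *\<^sub>C id_blinfun))"
  have D_0: "D 0 x = x" and D_Suc: "D (Suc k) x = D k (V x - \<mu> k *\<^sub>C x)" for k x
    by (simp_all add: D_def blinfun.diff_left scaleC_blinfun.rep_eq)
  have D_scale: "D k (c *\<^sub>C x) = c *\<^sub>C D k x" for k c x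
  proof (induction k arbitrary: x)
    case (Suc k)
    have "D (Suc k) (c *\<^sub>C x) = D k (c *\<^sub>C (V x - \<mu> k *\<^sub>C x))"
      by (simp add: D_Suc bounded_opsD[OF V] scaleC_diff_right scaleC_scaleC mult.commute)
    then show ?case by (simp add: Suc.IH D_Suc)
  qed (simp add: D_0)
  have D_V: "D k (V x) = V (D k x)" for k x
  proof (induction k arbitrary: x)
    case (Suc k)
    have "D (Suc k) (V x) = D k (V (V x - \<mu> k *\<^sub>C x))"
      by (simp add: D_Suc bounded_opsD[OF V] blinfun.diff_right)
    then show ?case by (simp add: Suc.IH D_Suc)
  qed (simp add: D_0)
  define M where "M k = {x. D k x = 0}" for k
  have M_sub: "subspace (M k)" for k
    by (auto simp: M_def subspace_def blinfun.add_right blinfun.scaleR_right)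
  have M_closed: "closed (M k)" for k
    unfolding M_def by (intro closed_Collect_eq continuous_intros)
  have M_scale: "c *\<^sub>C x \<in> M k" if "x \<in> M k" for c x k
    using that by (simp add: M_def D_scale scaleC_zero_right)
  have M_V: "V x \<in> M k" if "x \<in> M k" for x k
    using that by (simp add: M_def D_V)
  have M_Suc: "V x - \<mu> k *\<^sub>C x \<in> M k" if "x \<in> M (Suc k)" for x k
    using that by (simp add: M_def D_Suc)
  have M_le_Suc: "M k \<subseteq> M (Suc k)" for k
    by (auto simp: M_def D_Suc blinfun.diff_right D_V D_scale scaleC_zero_right)
  then have M_mono: "M j \<subseteq> M k" if "j \<le> k" for j k
    using that by (rule lift_Suc_mono_le)
  have "\<exists>x. x \<in> M (Suc k) \<and> x \<notin> M k" for k
  proof -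
    obtain x where x: "x \<noteq> 0" "V x = \<mu> k *\<^sub>C x" using eigen by blast
    have "D j x \<noteq> 0" if "j \<le> k" for j
      using that
    proof (induction j)
      case (Suc j)
      have "\<mu> k - \<mu> j \<noteq> 0" using Suc.prems inj by (auto dest: injD)
      moreover have "D (Suc j) x = (\<mu> k - \<mu> j) *\<^sub>C D j x"
        by (simp add: D_Suc x(2) D_scale scaleC_diff_left[symmetric])
      moreover have "D j x \<noteq> 0" using Suc by simp
      ultimately show ?case by (metis mult_eq_0_iff norm_eq_zero norm_scaleC)
    qed (simp add: D_0 x)
    moreover have "D (Suc k) x = 0" by (simp add: D_Suc x(2))
    ultimately show ?thesis by (auto simp: M_def)
  qed
  then have "\<exists>y. y \<in> M (Suc k) \<and> norm y = 1 \<and> (\<forall>v\<in>M k. 1 / 2 \<le> norm (y - v))" for k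
    using riesz_lemma[OF M_sub M_closed M_sub M_le_Suc, of _ k] by metis
  then obtain y where y: "\<And>k. y k \<in> M (Suc k)" "\<And>k. norm (y k) = 1"
      "\<And>k v. v \<in> M k \<Longrightarrow> 1 / 2 \<le> norm (y k - v)"
    by metis
  have apart: "m / 2 \<le> norm (V (y k - y j))" if "j < k" for j k
  proof -
    have "\<mu> k \<noteq> 0" using \<mu>_ge[of k] a m by auto
    \<comment> \<open>Chosen so that \<open>V (y\<^sub>k - y\<^sub>j) = \<mu>\<^sub>k (y\<^sub>k - v)\<close>; both parts of \<open>v\<close> lie in \<open>M k\<close>, the second because \<open>j < k\<close>.\<close>
    define v where "v = - inverse (\<mu> k) *\<^sub>C ((V (y k) - \<mu> k *\<^sub>C y k) - V (y j))"
    have "y j \<in> M k" using y(1)[of j] M_mono[of "Suc j" k] that by auto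
    then have v: "v \<in> M k"
      unfolding v_def by (intro M_scale subspace_diff[OF M_sub] M_Suc M_V y(1))
    have "V (y k - y j) = \<mu> k *\<^sub>C (y k - v)"
      using \<open>\<mu> k \<noteq> 0\<close>
      by (simp add: v_def scaleC_diff_right scaleC_minus_left scaleC_minus_right scaleC_scaleC scaleC_one
          blinfun.diff_right)
    moreover have "m * (1 / 2) \<le> cmod (\<mu> k) * norm (y k - v)"
      using \<mu>_ge[of k] a m y(3)[OF v] by (intro mult_mono) auto
    ultimately show ?thesis by (simp add: norm_scaleC)
  qed
  obtain l r where r: "strict_mono (r :: nat \<Rightarrow> nat)" "(\<lambda>n. C (y (r n))) \<longlonglongrightarrow> l"
    using compact_ops_subsequence[OF C, of y] y(2) by (metis order_refl)
  define \<eta> where "\<eta> = (m / 2 - 2 * a) / (b + 1)"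
  have \<eta>: "\<eta> > 0" using m b by (simp add: \<eta>_def)
  then obtain n0 where n0: "\<And>i j. i \<ge> n0 \<Longrightarrow> j \<ge> n0 \<Longrightarrow> dist (C (y (r i))) (C (y (r j))) < \<eta>"
    using LIMSEQ_imp_Cauchy[OF r(2)] unfolding Cauchy_def by blast
  define j k where "j = r n0" and "k = r (Suc n0)"
  have "j < k" using r(1) by (simp add: j_def k_def strict_mono_def)
  have C_less: "norm (C (y k - y j)) < \<eta>"
    using n0[of "Suc n0" n0] by (simp add: j_def k_def dist_norm blinfun.diff_right)
  have "norm (y k - y j) \<le> 2" using norm_triangle_ineq4[of "y k" "y j"] by (simp add: y(2))
  then have "a * norm (y k - y j) \<le> a * 2" using a by (rule mult_left_mono)
  moreover have "b * norm (C (y k - y j)) \<le> b * \<eta>"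
    using less_imp_le[OF C_less] b by (rule mult_left_mono)
  ultimately have "m / 2 \<le> a * 2 + b * \<eta>"
    using apart[OF \<open>j < k\<close>] V_le[of "y k - y j"] by linarith
  also have "\<dots> < a * 2 + (b + 1) * \<eta>" using \<eta> by (simp add: distrib_right)
  also have "\<dots> = m / 2" using b by (simp add: \<eta>_def)
  finally show False by simp
qed

text \<open>
  For \<open>w\<close> near \<open>z\<close> outside the spectrum put \<open>V = (w - A)\<^sup>-\<^sup>1\<close>. Composing the parametrix identity with \<open>V\<close>
  gives \<open>V = S + (z - w) S V - K V\<close>, so that \<open>\<parallel>V y\<parallel> \<le> 2 \<parallel>S\<parallel> \<parallel>y\<parallel> + 2 \<parallel>K V y\<parallel>\<close> as soon as
  \<open>\<bar>z - w\<bar> \<parallel>S\<parallel> \<le> 1/2\<close>. The bound \<open>2 \<parallel>S\<parallel>\<close> does not depend on \<open>w\<close>, while an eigenvalue \<open>v\<close> of \<open>A\<close> is an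
  eigenvalue \<open>1 / (w - v)\<close> of \<open>V\<close>, which is large when \<open>v\<close> and \<open>w\<close> are both near \<open>z\<close>.
\<close>

lemma finite_eigenvalues_near_frontier:
  fixes A :: "'a::complex_banach \<Rightarrow>\<^sub>L 'a"
  assumes A: "A \<in> bounded_ops"
    and S: "S o\<^sub>L (z *\<^sub>C id_blinfun - A) = id_blinfun + K" and K: "K \<in> compact_ops"
    and z: "z \<in> frontier (op_spectrum A)"
  obtains \<delta> where "\<delta> > 0" "finite (ball z \<delta> \<inter> {w. \<exists>x. x \<noteq> 0 \<and> A x = w *\<^sub>C x})"
proof -
  \<comment> \<open>Chosen so that \<open>1 / (2 \<delta>) = 8 \<parallel>S\<parallel> + 1\<close> exceeds four times the bound \<open>2 \<parallel>S\<parallel>\<close>.\<close>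
  define \<delta> where "\<delta> = 1 / (16 * norm S + 2)"
  have pos: "16 * norm S + 2 > 0" by (simp add: add_nonneg_pos)
  then have \<delta>: "\<delta> > 0" by (simp add: \<delta>_def)
  have \<delta>S: "\<delta> * norm S \<le> 1 / 2" using pos by (simp add: \<delta>_def field_simps)
  obtain w where w: "w \<notin> op_spectrum A" "dist z w < \<delta>"
    using z \<delta> unfolding frontier_straddle by blast
  then obtain V where V: "V o\<^sub>L (w *\<^sub>C id_blinfun - A) = id_blinfun"
      "(w *\<^sub>C id_blinfun - A) o\<^sub>L V = id_blinfun"
    by (auto simp: op_spectrum_def blinfun_invertible_def)
  have V1: "w *\<^sub>C V y - A (V y) = y" and V2: "V (w *\<^sub>C y - A y) = y" for y
    using compose_eqD[OF V(1), of y] compose_eqD[OF V(2), of y] by (simp_all add: shifted_apply)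
  have V_ops: "V \<in> bounded_ops"
    by (rule inverse_mem_bounded_ops[OF shifted_mem_bounded_ops[OF A] V])
  define C where "C = K o\<^sub>L V"
  have C: "C \<in> compact_ops" unfolding C_def by (rule compact_ops_compose_right[OF K V_ops])
  have V_le: "norm (V y) \<le> (2 * norm S) * norm y + 2 * norm (C y)" for y
  proof -
    have "S (z *\<^sub>C V y - A (V y)) = V y + C y"
      using compose_eqD[OF S, of "V y"] by (simp add: C_def shifted_apply blinfun.add_left)
    moreover have "z *\<^sub>C V y - A (V y) = y + (z - w) *\<^sub>C V y"
      using V1[of y] by (simp add: scaleC_diff_left algebra_simps)
    ultimately have "V y = S y + S ((z - w) *\<^sub>C V y) - C y"
      by (simp add: blinfun.add_right algebra_simps)
    then have "norm (V y) \<le> norm (S y) + norm (S ((z - w) *\<^sub>C V y)) + norm (C y)"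
      by (smt (verit) norm_triangle_ineq norm_triangle_ineq4)
    also have "norm (S ((z - w) *\<^sub>C V y)) \<le> norm S * (cmod (z - w) * norm (V y))"
      using norm_blinfun[of S "(z - w) *\<^sub>C V y"] by (simp add: norm_scaleC)
    also have "\<dots> \<le> norm S * (\<delta> * norm (V y))"
      using w(2) by (intro mult_left_mono mult_right_mono) (auto simp: dist_norm)
    also have "norm S * (\<delta> * norm (V y)) \<le> 1 / 2 * norm (V y)"
      using mult_right_mono[OF \<delta>S norm_ge_zero[of "V y"]] by (simp add: mult_ac)
    finally show ?thesis using norm_blinfun[of S y] by simp
  qed
  have "finite {\<mu>. 8 * norm S + 1 \<le> cmod \<mu> \<and> (\<exists>x. x \<noteq> 0 \<and> V x = \<mu> *\<^sub>C x)}" (is "finite ?E")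
    by (rule finite_large_eigenvalues[OF V_ops C _ _ V_le]) auto
  moreover have "ball z \<delta> \<inter> {w. \<exists>x. x \<noteq> 0 \<and> A x = w *\<^sub>C x} \<subseteq> (\<lambda>\<mu>. w - inverse \<mu>) ` ?E"
  proof clarify
    fix v x assume v: "v \<in> ball z \<delta>" and x: "x \<noteq> 0" "A x = v *\<^sub>C x"
    have "(w - v) *\<^sub>C V x = x"
      using V2[of x] by (simp add: x(2) scaleC_diff_left[symmetric] bounded_opsD[OF V_ops])
    then have wv: "w - v \<noteq> 0" using x(1) scaleC_zero_left[of "V x"] by force
    then have "V x = inverse (w - v) *\<^sub>C x"
      using \<open>(w - v) *\<^sub>C V x = x\<close> scaleC_scaleC[of "inverse (w - v)" "w - v" "V x"]
      by (simp add: scaleC_one)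
    moreover have "8 * norm S + 1 \<le> cmod (inverse (w - v))"
    proof -
      have "cmod (w - v) \<le> 2 * \<delta>"
        using dist_triangle[of w v z] v w(2) by (simp add: dist_norm norm_minus_commute)
      also have "2 * \<delta> = 1 / (8 * norm S + 1)" using pos by (simp add: \<delta>_def field_simps)
      finally have "inverse (1 / (8 * norm S + 1)) \<le> inverse (cmod (w - v))"
        using wv by (intro le_imp_inverse_le) auto
      then show ?thesis by (simp add: norm_inverse del: inverse_eq_divide)
    qed
    ultimately have "inverse (w - v) \<in> ?E" using x(1) by blast
    then show "v \<in> (\<lambda>\<mu>. w - inverse \<mu>) ` ?E"
      by (rule rev_image_eqI) simp
  qed
  ultimately have "finite (ball z \<delta> \<inter> {w. \<exists>x. x \<noteq> 0 \<and> A x = w *\<^sub>C x})" by (rule finite_surj)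
  with \<delta> show ?thesis by (rule that)
qed

text \<open>
  Outside a disc around \<open>0\<close> the frontier of the spectrum consists of eigenvalues and has no
  limit point, so by compactness it is finite there. The exterior of the disc without these finitely
  many points is connected, misses the frontier, and contains points of large modulus, which are not in
  the spectrum; hence it contains no spectral point at all. Only finitely many radii are excluded.
\<close>

lemma resolvent_circle:
  fixes A :: "'a::complex_banach \<Rightarrow>\<^sub>L 'a"
  assumes A: "A \<in> bounded_ops"
    and param: "\<And>z. z \<noteq> 0 \<Longrightarrow> \<exists>S K. K \<in> compact_ops \<and> S o\<^sub>L (z *\<^sub>C id_blinfun - A) = id_blinfun + K"
    and R: "R > 0"
  obtains r where "0 < r" "r < R" "\<And>z. cmod z = r \<Longrightarrow> z \<notin> op_spectrum A"
proof -
  define F where "F = frontier (op_spectrum A) - ball 0 (R / 2)"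
  have z0: "z \<noteq> 0" if "z \<in> F" for z using that R by (auto simp: F_def)
  have eigen: "\<exists>x. x \<noteq> 0 \<and> A x = z *\<^sub>C x" if z: "z \<in> F" for z
  proof -
    obtain S K where K: "K \<in> compact_ops" and S: "S o\<^sub>L (z *\<^sub>C id_blinfun - A) = id_blinfun + K"
      using param[OF z0[OF z]] by blast
    have zf: "z \<in> frontier (op_spectrum A)" using z by (simp add: F_def)
    have approx: "\<exists>x. norm x = 1 \<and> norm (z *\<^sub>C x - A x) < e" if "e > 0" for e
      by (rule frontier_op_spectrum_not_bounded_below[OF zf that]) (intro exI conjI)
    obtain x where "x \<noteq> 0" "A x = z *\<^sub>C x"
      by (rule eigenvector_of_approximate[OF S K approx])
    then show ?thesis by blast
  qed
  have "finite F"
  proof (rule ccontr)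
    assume inf: "infinite F"
    have "op_spectrum A \<subseteq> cball 0 (norm A)" by (auto simp: op_spectrum_norm_le)
    then have "bounded F"
      using frontier_subset_closed[OF closed_op_spectrum, of A]
      by (intro bounded_subset[OF bounded_cball]) (auto simp: F_def)
    moreover have "closed F" unfolding F_def by (intro closed_Diff) auto
    ultimately have "compact F" by (simp add: compact_eq_bounded_closed)
    then obtain z where z: "z \<in> F" "z islimpt F"
      using Heine_Borel_imp_Bolzano_Weierstrass[of F F] inf by blast
    obtain S K where K: "K \<in> compact_ops" and S: "S o\<^sub>L (z *\<^sub>C id_blinfun - A) = id_blinfun + K"
      using param[OF z0[OF z(1)]] by blast
    obtain \<delta> where "\<delta> > 0" "finite (ball z \<delta> \<inter> {w. \<exists>x. x \<noteq> 0 \<and> A x = w *\<^sub>C x})"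
    proof (rule finite_eigenvalues_near_frontier[OF A S K])
      show "z \<in> frontier (op_spectrum A)" using z(1) by (simp add: F_def)
    qed
    moreover have "F \<inter> ball z \<delta> \<subseteq> ball z \<delta> \<inter> {w. \<exists>x. x \<noteq> 0 \<and> A x = w *\<^sub>C x}"
      using eigen by auto
    ultimately show False using z(2) finite_subset unfolding islimpt_eq_infinite_ball by blast
  qed
  define U where "U = - cball (0 :: complex) (R / 2) - F"
  have "connected U"
    unfolding U_def
  proof (rule connected_open_diff_countable)
    show "connected (- cball (0 :: complex) (R / 2))"
      by (intro connected_complement_bounded_convex) auto
    show "open (- cball (0 :: complex) (R / 2))" by (intro open_Compl closed_cball)
    show "countable F" by (rule countable_finite[OF \<open>finite F\<close>])
  qed simp
  moreover have "U \<inter> frontier (op_spectrum A) = {}"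
    by (auto simp: U_def F_def)
  moreover have "U - op_spectrum A \<noteq> {}"
  proof -
    define z where "z = complex_of_real (norm A + R + (\<Sum>w\<in>F. cmod w))"
    have nz: "cmod z = norm A + R + (\<Sum>w\<in>F. cmod w)"
      unfolding z_def norm_of_real using R by (simp add: sum_nonneg)
    have "cmod w \<le> (\<Sum>w\<in>F. cmod w)" if "w \<in> F" for w
      using \<open>finite F\<close> that by (intro member_le_sum) auto
    then have "cmod z \<le> (\<Sum>w\<in>F. cmod w)" if "z \<in> F" using that by blast
    then have "z \<notin> F" using nz R norm_ge_zero[of A] by linarith
    moreover have "cmod z \<ge> norm A + R"
      unfolding nz by (simp add: sum_nonneg)
    then have "cmod z > R / 2" "cmod z > norm A" using R norm_ge_zero[of A] by linarith+
    then have "z \<notin> cball 0 (R / 2)" "z \<notin> op_spectrum A"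
      using op_spectrum_norm_le[of z A] by auto
    ultimately have "z \<in> U - op_spectrum A" by (simp add: U_def)
    then show ?thesis by blast
  qed
  ultimately have disj: "U \<inter> op_spectrum A = {}"
    using connected_Int_frontier[of U "op_spectrum A"] by fastforce
  have "infinite ({R / 2<..<R} - cmod ` F)"
    using R \<open>finite F\<close> by (intro Diff_infinite_finite) auto
  then have "{R / 2<..<R} - cmod ` F \<noteq> {}" by (rule infinite_imp_nonempty)
  then obtain r where r: "r \<in> {R / 2<..<R}" "r \<notin> cmod ` F" by blast
  show ?thesis
  proof (rule that[of r])
    fix z assume "cmod z = r"
    then have "z \<in> U" using r by (auto simp: U_def)
    then show "z \<notin> op_spectrum A" using disj by blast
  qed (use r R in auto)
qed

section \<open>Riesz operators in the Calkin algebra\<close>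

text \<open>
  A representative \<open>S\<close> of the inverse class works: equal cosets have a compact difference.
\<close>

lemma calkin_unit_parametrix:
  fixes T :: "'a::complex_banach \<Rightarrow>\<^sub>L 'a"
  assumes T: "T \<in> bounded_ops" and unit: "calkin_class T \<in> Units calkin"
  shows "\<exists>S K. K \<in> compact_ops \<and> S o\<^sub>L T = id_blinfun + K"
proof -
  interpret ideal compact_ops "op_ring :: ('a \<Rightarrow>\<^sub>L 'a) ring" by (rule ideal_compact_ops)
  obtain Y where Y: "Y \<in> carrier calkin" "Y \<otimes>\<^bsub>calkin\<^esub> calkin_class T = \<one>\<^bsub>calkin\<^esub>"
    using unit by (auto simp: Units_def)
  then obtain S where S: "S \<in> carrier op_ring" "Y = compact_ops +>\<^bsub>op_ring\<^esub> S"
    by (auto simp: calkin_def FactRing_def A_RCOSETS_def RCOSETS_def a_r_coset_def)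
  have T': "T \<in> carrier op_ring" using T by (simp add: op_ring_def)
  have "compact_ops +>\<^bsub>op_ring\<^esub> (S \<otimes>\<^bsub>op_ring\<^esub> T) = compact_ops +>\<^bsub>op_ring\<^esub> \<one>\<^bsub>op_ring\<^esub>"
    using Y(2) rcoset_mult_add[OF S(1) T'] by (simp add: calkin_def calkin_class_def FactRing_def S(2))
  then have "S \<otimes>\<^bsub>op_ring\<^esub> T \<in> compact_ops +>\<^bsub>op_ring\<^esub> \<one>\<^bsub>op_ring\<^esub>"
    using a_rcos_self[OF m_closed[OF S(1) T']] by simp
  then show ?thesis
    by (auto simp: a_r_coset_def r_coset_def op_ring_def add.commute)
qed

lemma invertible_calkin_unit:
  fixes T :: "'a::complex_banach \<Rightarrow>\<^sub>L 'a"
  assumes T: "T \<in> bounded_ops" and inv: "blinfun_invertible T"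
  shows "calkin_class T \<in> Units calkin"
proof -
  interpret ideal compact_ops "op_ring :: ('a \<Rightarrow>\<^sub>L 'a) ring" by (rule ideal_compact_ops)
  obtain V where V: "V o\<^sub>L T = id_blinfun" "T o\<^sub>L V = id_blinfun"
    using inv by (auto simp: blinfun_invertible_def)
  have ops: "T \<in> carrier op_ring" "V \<in> carrier op_ring"
    using T inverse_mem_bounded_ops[OF T V] by (simp_all add: op_ring_def)
  have "V \<otimes>\<^bsub>op_ring\<^esub> T = \<one>\<^bsub>op_ring\<^esub>" "T \<otimes>\<^bsub>op_ring\<^esub> V = \<one>\<^bsub>op_ring\<^esub>"
    using V by (simp_all add: op_ring_def)
  then have "calkin_class V \<otimes>\<^bsub>calkin\<^esub> calkin_class T = \<one>\<^bsub>calkin\<^esub>"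
    "calkin_class T \<otimes>\<^bsub>calkin\<^esub> calkin_class V = \<one>\<^bsub>calkin\<^esub>"
    using rcoset_mult_add ops by (simp_all add: calkin_def calkin_class_def FactRing_def)
  moreover have "calkin_class T \<in> carrier calkin" "calkin_class V \<in> carrier calkin"
    using ops by (simp_all add: calkin_def calkin_class_def FactRing_def a_rcosetsI[OF a_subset])
  ultimately show ?thesis unfolding Units_def by blast
qed

lemma riesz_operator_parametrix:
  assumes "riesz_operator A" "z \<noteq> 0"
  shows "\<exists>S K. K \<in> compact_ops \<and> S o\<^sub>L (z *\<^sub>C id_blinfun - A) = id_blinfun + K"
proof (rule calkin_unit_parametrix)
  show "z *\<^sub>C id_blinfun - A \<in> bounded_ops"
    using assms by (simp add: riesz_operator_def shifted_mem_bounded_ops)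
  have "z \<notin> essential_spectrum A" using assms by (simp add: riesz_operator_def)
  then show "calkin_class (z *\<^sub>C id_blinfun - A) \<in> Units calkin"
    by (simp add: essential_spectrum_def)
qed

text \<open>
  An inverse of \<open>A\<close> would keep \<open>0\<close> out of the essential spectrum. Here the infinite dimension of the
  space enters: in finite dimension the Calkin algebra is trivial and every essential spectrum is empty.
\<close>

lemma riesz_operator_not_invertible:
  assumes "riesz_operator A"
  shows "\<not> blinfun_invertible A"
proof
  assume "blinfun_invertible A"
  then obtain V where V: "V o\<^sub>L A = id_blinfun" "A o\<^sub>L V = id_blinfun"
    by (auto simp: blinfun_invertible_def)
  have "(- V) o\<^sub>L (- A) = id_blinfun" "(- A) o\<^sub>L (- V) = id_blinfun"
    using compose_eqD[OF V(1)] compose_eqD[OF V(2)]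
    by (auto intro!: blinfun_eqI simp: blinfun.minus_left blinfun.minus_right)
  then have "blinfun_invertible (- A)" unfolding blinfun_invertible_def by blast
  moreover have "- A \<in> bounded_ops"
    using assms by (simp add: riesz_operator_def bounded_ops_def blinfun.minus_left scaleC_minus_right)
  ultimately have "0 \<notin> essential_spectrum A"
    by (simp add: essential_spectrum_def scaleC_zero_left invertible_calkin_unit)
  then show False using assms by (simp add: riesz_operator_def)
qed

section \<open>Integrals of the resolvent over a circle\<close>

lemma bounded_bilinear_scaleC:
  "bounded_bilinear (\<lambda>c x. c *\<^sub>C (x :: 'a::complex_normed_vector))"
proof
  show "(r *\<^sub>R c) *\<^sub>C x = r *\<^sub>R c *\<^sub>C x" for r c and x :: 'a
    by (rule linear_scale[OF bounded_linear.linear[OF bounded_linear_scaleC_left]])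
  show "\<exists>K. \<forall>c x. norm (c *\<^sub>C (x :: 'a)) \<le> norm c * norm x * K"
    by (intro exI[of _ 1]) (simp add: norm_scaleC)
qed (simp_all add: scaleC_add_left scaleC_add_right scaleC_scaleR)

lemma has_integral_cis_power:
  assumes "m > 0"
  shows "((\<lambda>t. (complex_of_real r * cis t) ^ m) has_integral 0) {0..2 * pi}"
proof -
  define c where "c = complex_of_real r ^ m"
  have "((\<lambda>t. c * cis (real m * t)) has_integral
      (c / (\<i> * m) * cis (real m * (2 * pi)) - c / (\<i> * m) * cis (real m * 0))) {0..2 * pi}"
  proof (rule fundamental_theorem_of_calculus)
    fix t
    show "((\<lambda>t. c / (\<i> * m) * cis (real m * t)) has_vector_derivative c * cis (real m * t))
        (at t within {0..2 * pi})"
    proof -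
      have "((\<lambda>w. c / (\<i> * m) * exp (\<i> * m * w)) has_field_derivative c * exp (\<i> * m * of_real t))
          (at (complex_of_real t))"
        using assms by (auto intro!: derivative_eq_intros)
      from has_vector_derivative_real_field[OF this] show ?thesis
        by (simp add: cis_conv_exp mult.assoc)
    qed
  qed simp
  moreover have "cis (real m * (2 * pi)) = 1"
    using cis_multiple_2pi[of "real m"] by (simp add: mult_ac)
  ultimately show ?thesis
    by (simp add: c_def power_mult_distrib Complex.DeMoivre)
qed

text \<open>
  Put \<open>I m = \<integral> z\<^sup>m (z - A)\<^sup>-\<^sup>1 dt\<close> over the circle \<open>z = r e\<^sup>i\<^sup>t\<close>, so that \<open>P = I 1\<close> is \<open>2\<pi>\<close> times the Riesz projection. Since
  \<open>A (z - A)\<^sup>-\<^sup>1 = z (z - A)\<^sup>-\<^sup>1 - 1\<close> and \<open>\<integral> z\<^sup>m dt = 0\<close> for \<open>m > 0\<close>, one has \<open>A (I m) = I (m + 1)\<close> for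
  \<open>m > 0\<close> but \<open>A (I 0) = I 1 - 2\<pi>\<close>. The first relation gives the decay. By the second, \<open>I 1 = 0\<close>
  would make \<open>- I 0 / 2\<pi>\<close> an inverse of \<open>A\<close>. The resolvent has to be continuous on the circle for these
  integrals to exist, which follows from the resolvent identity.
\<close>

lemma operator_decaying_along_powers:
  fixes A :: "'a::complex_banach \<Rightarrow>\<^sub>L 'a"
  assumes A: "A \<in> bounded_ops" and r: "r > 0" and circle: "\<And>z. cmod z = r \<Longrightarrow> z \<notin> op_spectrum A"
    and A_inv: "\<not> blinfun_invertible A"
  obtains P :: "'a \<Rightarrow>\<^sub>L 'a" and C where "P \<noteq> 0" "C \<ge> 0"
    "\<And>n x. norm ((blinfun_apply A ^^ n) (P x)) \<le> C * r ^ n * norm x"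
    "\<And>n x. norm (P ((blinfun_apply A ^^ n) x)) \<le> C * r ^ n * norm x"
proof -
  define z where "z t = complex_of_real r * cis t" for t
  have cz: "cmod (z t) = r" for t using r by (simp add: z_def norm_mult)
  have "\<exists>V. V o\<^sub>L (z t *\<^sub>C id_blinfun - A) = id_blinfun \<and> (z t *\<^sub>C id_blinfun - A) o\<^sub>L V = id_blinfun" for t
    using circle[OF cz] by (auto simp: op_spectrum_def blinfun_invertible_def)
  then obtain R where R: "\<And>t. R t o\<^sub>L (z t *\<^sub>C id_blinfun - A) = id_blinfun"
      "\<And>t. (z t *\<^sub>C id_blinfun - A) o\<^sub>L R t = id_blinfun"
    by metis
  have R1: "A (R t x) = z t *\<^sub>C R t x - x" for t x
    using compose_eqD[OF R(2), of t x] by (simp add: shifted_apply algebra_simps)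
  have R2: "R t (A x) = z t *\<^sub>C R t x - x" for t x
    using compose_eqD[OF R(1), of t x]
      bounded_opsD[OF inverse_mem_bounded_ops[OF shifted_mem_bounded_ops[OF A] R], of t "z t" x]
    by (simp add: shifted_apply blinfun.diff_right algebra_simps)
  have resolvent_eq: "R t - R s = (z s - z t) *\<^sub>C (R t o\<^sub>L R s)" for s t
  proof (rule blinfun_eqI)
    fix x
    have "R t x = R t (z s *\<^sub>C R s x - A (R s x))" by (simp add: R1)
    also have "\<dots> = R t ((z s - z t) *\<^sub>C R s x) + R t (z t *\<^sub>C R s x - A (R s x))"
      by (simp add: scaleC_diff_left flip: blinfun.add_right)
    also have "R t (z t *\<^sub>C R s x - A (R s x)) = R s x"
      using compose_eqD[OF R(1), of t "R s x"] by (simp add: shifted_apply)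
    finally show "(R t - R s) x = ((z s - z t) *\<^sub>C (R t o\<^sub>L R s)) x"
      by (simp add: blinfun.diff_left scaleC_blinfun.rep_eq
          bounded_opsD[OF inverse_mem_bounded_ops[OF shifted_mem_bounded_ops[OF A] R]])
  qed
  have z_cont: "continuous_on S z" for S unfolding z_def by (intro continuous_intros)
  have R_cont: "continuous_on S R" for S
  proof (intro continuous_at_imp_continuous_on ballI)
    fix s
    have z_lim: "(z \<longlongrightarrow> z s) (at s)"
      using z_cont[of UNIV] by (simp add: continuous_on_def)
    then have lim0: "((\<lambda>t. 2 * norm (R s) ^ 2 * cmod (z s - z t)) \<longlongrightarrow> 0) (at s)"
      by (auto intro!: tendsto_eq_intros)
    have near: "\<forall>\<^sub>F t in at s. dist (z t) (z s) < 1 / (2 * (norm (R s) + 1))"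
      by (rule tendstoD[OF z_lim]) (simp add: add_nonneg_pos)
    have "\<forall>\<^sub>F t in at s. norm (R t - R s) \<le> 2 * norm (R s) ^ 2 * cmod (z s - z t)"
      using near
    proof eventually_elim
      case (elim t)
      have "cmod (z s - z t) * (2 * (norm (R s) + 1)) < 1"
        using elim by (simp add: dist_norm norm_minus_commute pos_less_divide_eq add_nonneg_pos)
      then have small: "cmod (z s - z t) * norm (R s) \<le> 1 / 2"
        using norm_ge_zero[of "z s - z t"] by (simp add: distrib_left del: norm_ge_zero)
      have diff: "norm (R t - R s) \<le> cmod (z s - z t) * (norm (R t) * norm (R s))"
        unfolding resolvent_eq[of t s] norm_scaleC by (intro mult_left_mono norm_blinfun_compose) simp
      also have "\<dots> = (cmod (z s - z t) * norm (R s)) * norm (R t)" by simp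
      also have "\<dots> \<le> 1 / 2 * norm (R t)" by (intro mult_right_mono small) simp
      finally have "norm (R t) \<le> 2 * norm (R s)"
        using norm_triangle_ineq2[of "R t" "R s"] by simp
      then have "cmod (z s - z t) * (norm (R t) * norm (R s))
          \<le> cmod (z s - z t) * ((2 * norm (R s)) * norm (R s))"
        by (intro mult_left_mono mult_right_mono) auto
      then show ?case using diff by (simp add: power2_eq_square mult_ac)
    qed
    then have "((\<lambda>t. R t - R s) \<longlongrightarrow> 0) (at s)"
      by (rule Lim_null_comparison[OF _ lim0])
    then show "isCont R s" unfolding isCont_def by (simp add: LIM_zero_iff)
  qed
  let ?T = "{0..2 * pi}"
  define I where "I m = integral ?T (\<lambda>t. z t ^ m *\<^sub>C R t)" for m
  have integrable: "(\<lambda>t. z t ^ m *\<^sub>C R t) integrable_on ?T" for m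
    by (intro integrable_continuous_interval bounded_bilinear.continuous_on[OF bounded_bilinear_scaleC]
        continuous_on_power z_cont R_cont)
  have I_apply: "((\<lambda>t. z t ^ m *\<^sub>C R t x) has_integral I m x) ?T" for m x
    using has_integral_linear[OF integrable_integral[OF integrable, of m] blinfun.bounded_linear_left[of x]]
    by (simp add: I_def o_def scaleC_blinfun.rep_eq)
  have scalar: "((\<lambda>t. z t ^ m *\<^sub>C x) has_integral (if m = 0 then 2 * pi else 0) *\<^sub>R x) ?T" for m and x :: 'a
  proof (cases "m = 0")
    case True
    then show ?thesis using has_integral_const_real[of x 0 "2 * pi"] by (simp add: scaleC_one)
  next
    case False
    then have "((\<lambda>t. z t ^ m) has_integral 0) ?T"
      unfolding z_def by (intro has_integral_cis_power) simp
    from has_integral_linear[OF this bounded_linear_scaleC_left[of x]] show ?thesis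
      using False by (simp add: o_def scaleC_zero_left)
  qed
  have A_I: "A (I m x) = I (Suc m) x - (if m = 0 then 2 * pi else 0) *\<^sub>R x" for m x
  proof -
    have "((\<lambda>t. A (z t ^ m *\<^sub>C R t x)) has_integral A (I m x)) ?T"
      using has_integral_linear[OF I_apply blinfun.bounded_linear_right] by (simp add: o_def)
    moreover have "((\<lambda>t. z t ^ Suc m *\<^sub>C R t x - z t ^ m *\<^sub>C x) has_integral
        (I (Suc m) x - (if m = 0 then 2 * pi else 0) *\<^sub>R x)) ?T"
      by (intro has_integral_diff I_apply scalar)
    moreover have "A (z t ^ m *\<^sub>C R t x) = z t ^ Suc m *\<^sub>C R t x - z t ^ m *\<^sub>C x" for t
      by (simp add: bounded_opsD[OF A] R1 scaleC_diff_right scaleC_scaleC mult.commute)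
    ultimately show ?thesis by (simp only: has_integral_unique)
  qed
  have I_A: "I m (A x) = I (Suc m) x - (if m = 0 then 2 * pi else 0) *\<^sub>R x" for m x
  proof -
    have "((\<lambda>t. z t ^ Suc m *\<^sub>C R t x - z t ^ m *\<^sub>C x) has_integral
        (I (Suc m) x - (if m = 0 then 2 * pi else 0) *\<^sub>R x)) ?T"
      by (intro has_integral_diff I_apply scalar)
    moreover have "z t ^ m *\<^sub>C R t (A x) = z t ^ Suc m *\<^sub>C R t x - z t ^ m *\<^sub>C x" for t
      by (simp add: R2 scaleC_diff_right scaleC_scaleC mult.commute)
    ultimately show ?thesis using I_apply[of m "A x"] by (simp only: has_integral_unique)
  qed
  have left: "(blinfun_apply A ^^ n) (I (Suc 0) x) = I (Suc n) x" for n x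
    by (induction n) (simp_all add: A_I)
  have right: "I (Suc 0) ((blinfun_apply A ^^ n) x) = I (Suc n) x" for n x
    by (induction n arbitrary: x) (simp_all add: I_A funpow_swap1)
  obtain M where M: "\<And>t. t \<in> ?T \<Longrightarrow> norm (R t) \<le> M"
    using compact_imp_bounded[OF compact_continuous_image[OF R_cont[of ?T]]]
    unfolding bounded_iff by blast
  have M0: "M \<ge> 0" using M[of 0] order_trans[OF norm_ge_zero] by simp
  have I_le: "norm (I m) \<le> 2 * pi * (r ^ m * M)" for m
  proof -
    have "norm (I m) \<le> integral ?T (\<lambda>t. r ^ m * M)"
      unfolding I_def
      using M r by (intro integral_norm_bound_integral integrable)
        (auto simp: norm_scaleC norm_power cz intro!: mult_left_mono)
    also have "\<dots> = 2 * pi * (r ^ m * M)" by (subst integral_const_real) simp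
    finally show ?thesis .
  qed
  have I_le': "norm (I (Suc n) x) \<le> (2 * pi * r * M) * r ^ n * norm x" for n x
  proof -
    have "norm (I (Suc n) x) \<le> 2 * pi * (r ^ Suc n * M) * norm x"
      by (intro order_trans[OF norm_blinfun] mult_right_mono I_le) simp
    then show ?thesis by (simp add: mult_ac)
  qed
  have "I (Suc 0) \<noteq> 0"
  proof
    assume "I (Suc 0) = 0"
    then have "(- inverse (2 * pi)) *\<^sub>R I 0 o\<^sub>L A = id_blinfun" "A o\<^sub>L (- inverse (2 * pi)) *\<^sub>R I 0 = id_blinfun"
      by (auto intro!: blinfun_eqI simp: I_A A_I blinfun.scaleR_left blinfun.scaleR_right blinfun.minus_left blinfun.minus_right)
    then show False using A_inv unfolding blinfun_invertible_def by blast
  qed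
  then show ?thesis
    by (rule that[of _ "2 * pi * r * M"]) (use r M0 in \<open>simp_all add: left right I_le'\<close>)
qed

section \<open>The Hahn-Banach theorem\<close>

definition sublinear :: "('a::real_vector \<Rightarrow> real) \<Rightarrow> bool" where
  "sublinear p \<longleftrightarrow> p 0 = 0 \<and> (\<forall>x y. p (x + y) \<le> p x + p y) \<and> (\<forall>t>0. \<forall>x. p (t *\<^sub>R x) \<le> t * p x)"

lemma sublinear_zero: "sublinear p \<Longrightarrow> p 0 = 0"
  and sublinear_add: "sublinear p \<Longrightarrow> p (x + y) \<le> p x + p y"
  and sublinear_scale_le: "sublinear p \<Longrightarrow> t > 0 \<Longrightarrow> p (t *\<^sub>R x) \<le> t * p x"
  by (auto simp: sublinear_def)

lemma sublinear_scale:
  assumes "sublinear p" "t \<ge> 0"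
  shows "p (t *\<^sub>R x) = t * p x"
proof (cases "t = 0")
  case False
  then have t: "t > 0" using assms by simp
  have "p (inverse t *\<^sub>R (t *\<^sub>R x)) \<le> inverse t * p (t *\<^sub>R x)"
    using t by (intro sublinear_scale_le assms(1)) simp
  then have "t * p x \<le> p (t *\<^sub>R x)" using t by (simp add: field_simps)
  then show ?thesis using sublinear_scale_le[OF assms(1) t, of x] by simp
qed (simp add: sublinear_zero[OF assms(1)])

lemma sublinear_ge: "sublinear p \<Longrightarrow> - p (- x) \<le> p x"
  using sublinear_add[of p x "- x"] sublinear_zero[of p] by simp

text \<open>
  The functional \<open>p' y = inf {p (y + t x) - t p x | t \<ge> 0}\<close> is the largest sublinear one below \<open>p\<close>
  with \<open>p' (- x) \<le> - p x\<close>. It serves twice: to push the norm down to \<open>- \<parallel>q\<parallel>\<close> at \<open>- q\<close>, and to show that minimal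
  sublinear functionals are additive.
\<close>

lemma sublinear_decrease_along:
  fixes p :: "'a::real_vector \<Rightarrow> real"
  assumes p: "sublinear p"
  obtains p' where "sublinear p'" "\<And>y. p' y \<le> p y" "\<And>y. p' y \<le> p (y + x) - p x"
proof -
  define g where "g y t = p (y + t *\<^sub>R x) - t * p x" for y t
  define p' where "p' y = (INF t\<in>{0..}. g y t)" for y
  have lower: "- p (- y) \<le> g y t" if "t \<ge> 0" for y t
    using sublinear_add[OF p, of "y + t *\<^sub>R x" "- y"] sublinear_scale[OF p that, of x]
    by (simp add: g_def)
  have le: "p' y \<le> g y t" if "t \<ge> 0" for y t
    unfolding p'_def using that lower by (intro cINF_lower bdd_belowI2[of _ "- p (- y)"]) auto
  have ge: "c \<le> p' y" if "\<And>t. t \<ge> 0 \<Longrightarrow> c \<le> g y t" for c y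
    unfolding p'_def using that by (intro cINF_greatest) auto
  have "sublinear p'"
    unfolding sublinear_def
  proof (intro conjI allI impI)
    show "p' 0 = 0"
      using le[of 0 0] ge[of 0 0] lower[of _ 0] sublinear_zero[OF p]
      by (force simp: g_def intro: antisym)
  next
    fix y z
    have "p' (y + z) - g z t \<le> g y s" if "s \<ge> 0" "t \<ge> 0" for s t
    proof -
      have "p' (y + z) \<le> g (y + z) (s + t)" using that by (intro le) simp
      also have "\<dots> \<le> g y s + g z t"
        using sublinear_add[OF p, of "y + s *\<^sub>R x" "z + t *\<^sub>R x"]
        by (simp add: g_def algebra_simps)
      finally show ?thesis by simp
    qed
    then have "p' (y + z) - g z t \<le> p' y" if "t \<ge> 0" for t
      using that by (intro ge) auto
    then have "p' (y + z) - p' y \<le> g z t" if "t \<ge> 0" for t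
      using that by (auto simp: algebra_simps)
    then have "p' (y + z) - p' y \<le> p' z" by (intro ge) auto
    then show "p' (y + z) \<le> p' y + p' z" by simp
  next
    fix c :: real and y assume c: "c > 0"
    have "p' (c *\<^sub>R y) / c \<le> g y t" if t: "t \<ge> 0" for t
    proof -
      have "p' (c *\<^sub>R y) \<le> g (c *\<^sub>R y) (c * t)" using t c by (intro le) simp
      also have "\<dots> = c * g y t"
        using sublinear_scale[OF p, of c "y + t *\<^sub>R x"] c by (simp add: g_def algebra_simps)
      finally show ?thesis using c by (simp add: field_simps)
    qed
    then have "p' (c *\<^sub>R y) / c \<le> p' y" by (rule ge)
    then show "p' (c *\<^sub>R y) \<le> c * p' y" using c by (simp add: field_simps)
  qed
  then show ?thesis using that le[of 0] le[of 1] by (simp add: g_def)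
qed

text \<open>
  Zorn's lemma, downwards: the pointwise infimum of a chain is sublinear, and it is finite because
  \<open>p x \<ge> - p (- x) \<ge> - p\<^sub>0 (- x)\<close> for every sublinear \<open>p\<close> below \<open>p\<^sub>0\<close>.
\<close>

lemma minimal_sublinear_below:
  fixes p0 :: "'a::real_vector \<Rightarrow> real"
  assumes p0: "sublinear p0"
  obtains u where "sublinear u" "u \<le> p0" "\<And>p. sublinear p \<Longrightarrow> p \<le> u \<Longrightarrow> p = u"
proof -
  define F where "F = {p. sublinear p \<and> p \<le> p0}"
  have "\<exists>m\<in>F. \<forall>p\<in>F. p \<le> m \<longrightarrow> p = m"
  proof (rule predicate_Zorn)
    show "partial_order_on F (relation_of (\<lambda>p q. q \<le> p) F)"
      by (rule partial_order_on_relation_ofI) auto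
  next
    fix C assume C: "C \<in> Chains (relation_of (\<lambda>p q. q \<le> p) F)"
    then have CF: "C \<subseteq> F" and total: "\<And>p q. p \<in> C \<Longrightarrow> q \<in> C \<Longrightarrow> p \<le> q \<or> q \<le> p"
      by (auto simp: Chains_def relation_of_def)
    show "\<exists>u\<in>F. \<forall>p\<in>C. u \<le> p"
    proof (cases "C = {}")
      case True
      then show ?thesis using p0 by (auto simp: F_def)
    next
      case False
      define u where "u x = (INF p\<in>C. p x)" for x
      have sub: "sublinear p" if "p \<in> C" for p using CF that by (auto simp: F_def)
      have le: "u x \<le> p x" if "p \<in> C" for p x
        unfolding u_def
      proof (intro cINF_lower bdd_belowI2[of _ "- p0 (- x)"] that)
        fix q assume "q \<in> C"
        then have "q (- x) \<le> p0 (- x)" using CF by (auto simp: F_def le_fun_def)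
        then show "- p0 (- x) \<le> q x" using sublinear_ge[OF sub[OF \<open>q \<in> C\<close>], of x] by simp
      qed
      have ge: "c \<le> u x" if "\<And>p. p \<in> C \<Longrightarrow> c \<le> p x" for c x
        unfolding u_def using that False by (intro cINF_greatest) auto
      have "sublinear u"
        unfolding sublinear_def
      proof (intro conjI allI impI)
        show "u 0 = 0" using False sub unfolding u_def by (simp add: sublinear_zero)
      next
        fix x y
        have "u (x + y) - q y \<le> p x" if pq: "p \<in> C" "q \<in> C" for p q
        proof -
          obtain r where r: "r \<in> C" "r \<le> p" "r \<le> q" using total[OF pq] pq by auto
          have "u (x + y) \<le> r x + r y"
            using le[OF r(1), of "x + y"] sublinear_add[OF sub[OF r(1)], of x y] by simp
          also have "\<dots> \<le> p x + q y" using r by (intro add_mono) (auto simp: le_fun_def)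
          finally show ?thesis by simp
        qed
        then have "u (x + y) - q y \<le> u x" if "q \<in> C" for q using that by (intro ge) auto
        then have "u (x + y) - u x \<le> q y" if "q \<in> C" for q
          using that by (auto simp: algebra_simps)
        then have "u (x + y) - u x \<le> u y" by (rule ge)
        then show "u (x + y) \<le> u x + u y" by simp
      next
        fix t :: real and x assume t: "t > 0"
        have "u (t *\<^sub>R x) / t \<le> p x" if "p \<in> C" for p
          using le[OF that, of "t *\<^sub>R x"] sublinear_scale[OF sub[OF that], of t x] t
          by (simp add: field_simps)
        then have "u (t *\<^sub>R x) / t \<le> u x" by (rule ge)
        then show "u (t *\<^sub>R x) \<le> t * u x" using t by (simp add: field_simps)
      qed
      moreover have "u \<le> p0"
      proof -
        obtain p where "p \<in> C" using False by blast
        then have "u \<le> p" "p \<le> p0" using le CF by (auto simp: le_fun_def F_def)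
        then show ?thesis by (rule order_trans)
      qed
      ultimately show ?thesis using le by (auto simp: F_def le_fun_def)
    qed
  qed
  then show ?thesis using that unfolding F_def by (auto intro: order_trans)
qed

text \<open>
  Hahn-Banach by minimality: a minimal sublinear functional \<open>u\<close> cannot be decreased along any \<open>x\<close>, which says
  \<open>u x + u y \<le> u (x + y)\<close>, so \<open>u\<close> is linear. Starting below the norm and below \<open>- \<parallel>q\<parallel>\<close> at \<open>- q\<close> gives \<open>u q \<ge> \<parallel>q\<parallel>\<close>.
\<close>

lemma exists_real_functional:
  fixes q :: "'a::real_normed_vector"
  obtains u :: "'a \<Rightarrow> real" where "bounded_linear u" "norm q \<le> u q"
proof -
  have "sublinear (norm :: 'a \<Rightarrow> real)"
    by (auto simp: sublinear_def norm_triangle_ineq)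
  then obtain p0 where p0: "sublinear p0" "\<And>y. p0 y \<le> norm y" "\<And>y. p0 y \<le> norm (y + q) - norm q"
    using sublinear_decrease_along[of norm q] by blast
  obtain u where u: "sublinear u" "u \<le> p0" and min: "\<And>p. sublinear p \<Longrightarrow> p \<le> u \<Longrightarrow> p = u"
    using minimal_sublinear_below[OF p0(1)] by blast
  have add: "u (x + y) = u x + u y" for x y
  proof -
    obtain p where p: "sublinear p" "\<And>z. p z \<le> u z" "\<And>z. p z \<le> u (z + x) - u x"
      using sublinear_decrease_along[OF u(1), of x] by blast
    then have "p = u" by (intro min) (auto simp: le_fun_def)
    then have "u y \<le> u (y + x) - u x" using p(3)[of y] by simp
    then show ?thesis using sublinear_add[OF u(1), of x y] by (simp add: add.commute)
  qed
  have minus: "u (- x) = - u x" for x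
    using add[of x "- x"] sublinear_zero[OF u(1)] by simp
  have le_norm: "u x \<le> norm x" for x
    using u(2) p0(2)[of x] by (auto simp: le_fun_def intro: order_trans)
  have "bounded_linear u"
  proof (rule bounded_linear_intro[of _ 1])
    show "u (r *\<^sub>R x) = r *\<^sub>R u x" for r x
      using sublinear_scale[OF u(1), of r x] sublinear_scale[OF u(1), of "- r" x] minus[of "r *\<^sub>R x"]
      by (cases "r \<ge> 0") auto
    show "norm (u x) \<le> norm x * 1" for x
      using le_norm[of x] le_norm[of "- x"] minus[of x] by auto
  qed (rule add)
  moreover have "norm q \<le> u q"
    using u(2) p0(3)[of "- q"] minus[of q] by (auto simp: le_fun_def dest!: spec[of _ "- q"])
  ultimately show ?thesis by (rule that)
qed

text \<open>
  The usual complexification \<open>x \<mapsto> u x - \<i> u (\<i> x)\<close> of a real functional \<open>u\<close>.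
\<close>

lemma exists_complex_functional:
  fixes q :: "'a::complex_normed_vector"
  assumes "q \<noteq> 0"
  obtains f :: "'a \<Rightarrow>\<^sub>L complex" where "f \<in> bounded_ops" "f q \<noteq> 0"
proof -
  obtain u :: "'a \<Rightarrow> real" where u: "bounded_linear u" "norm q \<le> u q"
    by (rule exists_real_functional)
  interpret u: bounded_linear u by (rule u(1))
  define h where "h x = complex_of_real (u x) - \<i> * complex_of_real (u (\<i> *\<^sub>C x))" for x
  have "bounded_linear h"
    unfolding h_def
    by (intro bounded_linear_sub bounded_linear_const_mult
        bounded_linear_compose[OF bounded_linear_of_real]
        bounded_linear_compose[OF u(1)] bounded_linear_scaleC_right u(1))
  then have app: "blinfun_apply (Blinfun h) = h" by (rule bounded_linear_Blinfun_apply)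
  have "h (c *\<^sub>C x) = c * h x" for c x
  proof -
    have c: "c *\<^sub>C x = Re c *\<^sub>R x + Im c *\<^sub>R (\<i> *\<^sub>C x)"
      by (simp add: scaleC_of_real[symmetric] scaleC_scaleC scaleC_add_left[symmetric]
          complex_eq[symmetric] mult.commute)
    have ic: "\<i> *\<^sub>C c *\<^sub>C x = Re c *\<^sub>R (\<i> *\<^sub>C x) - Im c *\<^sub>R x"
      by (simp add: c scaleC_add_right scaleC_scaleR scaleC_scaleC scaleC_minus_left scaleC_one)
    show ?thesis
      by (simp add: h_def ic u.diff u.scaleR) (simp add: c u.add u.scaleR complex_eq_iff)
  qed
  then have "Blinfun h \<in> bounded_ops" by (simp add: bounded_ops_def app scaleC_complex_def)
  moreover have "Blinfun h q \<noteq> 0"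
    using assms u(2) by (auto simp: app h_def complex_eq_iff)
  ultimately show ?thesis by (rule that)
qed

section \<open>Orbits of generalised derivations\<close>

lemma funpow_blinfun_diff:
  fixes A :: "'a::real_normed_vector \<Rightarrow>\<^sub>L 'a"
  shows "((blinfun_apply A) ^^ n) (x - y) = (blinfun_apply A ^^ n) x - (blinfun_apply A ^^ n) y"
  by (induction n) (simp_all add: blinfun.diff_right)

text \<open>
  Induction on \<open>n\<close> with \<open>j\<close> and \<open>k\<close> general replaces the binomial expansion of \<open>\<tau>\<^sup>n T\<close>: one
  application of the derivation produces two terms, in which \<open>j\<close> or \<open>k\<close> has grown by one, so each
  carries an additional factor \<open>1/2\<close>.
\<close>

lemma derivation_orbit_bound:
  fixes A B P T :: "'a::real_normed_vector \<Rightarrow>\<^sub>L 'a"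
  assumes C: "C \<ge> 0" and P: "\<And>n x. norm (P ((blinfun_apply A ^^ n) x)) \<le> C * (1 / 2) ^ n * norm x"
    and q: "\<And>n. norm ((blinfun_apply B ^^ n) q) \<le> D * (1 / 2) ^ n"
  shows "norm (P ((blinfun_apply A ^^ j) ((gen_derivation A B ^^ n) T ((blinfun_apply B ^^ k) q))))
    \<le> C * norm T * D * (1 / 2) ^ (j + k)"
proof (induction n arbitrary: j k)
  case 0
  have "norm (P ((blinfun_apply A ^^ j) (T ((blinfun_apply B ^^ k) q)))) \<le> C * (1 / 2) ^ j * norm (T ((blinfun_apply B ^^ k) q))"
    by (rule P)
  also have "\<dots> \<le> C * (1 / 2) ^ j * (norm T * (D * (1 / 2) ^ k))"
    using C by (intro mult_left_mono order_trans[OF norm_blinfun] q) auto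
  finally show ?case by (simp add: power_add mult_ac)
next
  case (Suc n)
  define U where "U = (gen_derivation A B ^^ n) T"
  have "P ((blinfun_apply A ^^ j) ((gen_derivation A B ^^ Suc n) T ((blinfun_apply B ^^ k) q)))
      = P ((blinfun_apply A ^^ Suc j) (U ((blinfun_apply B ^^ k) q))) - P ((blinfun_apply A ^^ j) (U ((blinfun_apply B ^^ Suc k) q)))"
    by (simp add: gen_derivation_def U_def[symmetric] blinfun.diff_left blinfun.diff_right
        funpow_blinfun_diff funpow_swap1)
  then have "norm (P ((blinfun_apply A ^^ j) ((gen_derivation A B ^^ Suc n) T ((blinfun_apply B ^^ k) q))))
      \<le> norm (P ((blinfun_apply A ^^ Suc j) (U ((blinfun_apply B ^^ k) q)))) + norm (P ((blinfun_apply A ^^ j) (U ((blinfun_apply B ^^ Suc k) q))))"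
    using norm_triangle_ineq4 by metis
  also have "\<dots> \<le> C * norm T * D * (1 / 2) ^ (Suc j + k) + C * norm T * D * (1 / 2) ^ (j + Suc k)"
    unfolding U_def by (intro add_mono Suc.IH)
  finally show ?case by (simp add: mult_ac)
qed

lemma riesz_operator_decay:
  fixes A :: "'a::complex_banach \<Rightarrow>\<^sub>L 'a"
  assumes A: "riesz_operator A"
  obtains P :: "'a \<Rightarrow>\<^sub>L 'a" and C where "P \<noteq> 0" "C \<ge> 0"
    "\<And>n x. norm ((blinfun_apply A ^^ n) (P x)) \<le> C * (1 / 2) ^ n * norm x"
    "\<And>n x. norm (P ((blinfun_apply A ^^ n) x)) \<le> C * (1 / 2) ^ n * norm x"
proof -
  have ops: "A \<in> bounded_ops" using A by (simp add: riesz_operator_def)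
  obtain r where r: "0 < r" "r < 1 / 2" and circle: "\<And>z. cmod z = r \<Longrightarrow> z \<notin> op_spectrum A"
    using resolvent_circle[OF ops riesz_operator_parametrix[OF A], of "1 / 2"] by auto
  obtain P :: "'a \<Rightarrow>\<^sub>L 'a" and C where P: "P \<noteq> 0" "C \<ge> 0"
      "\<And>n x. norm ((blinfun_apply A ^^ n) (P x)) \<le> C * r ^ n * norm x"
      "\<And>n x. norm (P ((blinfun_apply A ^^ n) x)) \<le> C * r ^ n * norm x"
    using operator_decaying_along_powers[OF ops r(1) circle riesz_operator_not_invertible[OF A]]
    by blast
  have le: "C * r ^ n * norm x \<le> C * (1 / 2) ^ n * norm x" for n and x :: 'a
    using r P(2) by (intro mult_right_mono mult_left_mono power_mono) auto
  show ?thesis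
    by (rule that[OF P(1,2)]) (rule order_trans[OF P(3) le] order_trans[OF P(4) le])+
qed

theorem theorem3p4:
  fixes J :: "('a::complex_banach \<Rightarrow>\<^sub>L 'a) set"
    and N :: "('a \<Rightarrow>\<^sub>L 'a) \<Rightarrow> real"
    and A B :: "'a \<Rightarrow>\<^sub>L 'a"
  assumes "banach_ideal J N"
    and "separable_wrt J N"
    and "riesz_operator A"
    and "riesz_operator B"
  shows "\<not> hypercyclic_on J N (gen_derivation A B)"
proof
  assume "hypercyclic_on J N (gen_derivation A B)"
  then obtain Y where dense: "dense_wrt J N (range (\<lambda>n. (gen_derivation A B ^^ n) Y))"
    by (auto simp: hypercyclic_on_def)
  interpret banach_ideal J N by (rule assms(1))
  obtain P :: "'a \<Rightarrow>\<^sub>L 'a" and C where P: "P \<noteq> 0" "C \<ge> 0"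
      "\<And>n x. norm (P ((blinfun_apply A ^^ n) x)) \<le> C * (1 / 2) ^ n * norm x"
    by (rule riesz_operator_decay[OF assms(3)]) (rule that)
  obtain Q :: "'a \<Rightarrow>\<^sub>L 'a" and D where Q: "Q \<noteq> 0"
      "\<And>n x. norm ((blinfun_apply B ^^ n) (Q x)) \<le> D * (1 / 2) ^ n * norm x"
    by (rule riesz_operator_decay[OF assms(4)]) (rule that)
  obtain x\<^sub>0 where x0: "Q x\<^sub>0 \<noteq> 0" using Q(1) blinfun_eqI[of Q 0] by auto
  obtain x\<^sub>1 where x1: "P x\<^sub>1 \<noteq> 0" using P(1) blinfun_eqI[of P 0] by auto
  define q where "q = Q x\<^sub>0"
  have q: "norm ((blinfun_apply B ^^ n) q) \<le> (D * norm x\<^sub>0) * (1 / 2) ^ n" for n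
    using Q(2)[of n x\<^sub>0] by (simp add: q_def mult_ac)
  define K where "K = C * norm Y * (D * norm x\<^sub>0)"
  have orbit: "norm (P ((gen_derivation A B ^^ n) Y q)) \<le> K" for n
    using derivation_orbit_bound[OF P(2,3) q, of 0 n Y 0] by (simp add: K_def)
  define M where "M = norm P * norm q + K"
  have bound: "norm (P (S q)) \<le> M" if S: "S \<in> J" for S
  proof -
    obtain n where n: "N (S - (gen_derivation A B ^^ n) Y) < 1"
      using dense S unfolding dense_wrt_def by (auto dest!: bspec[of _ _ S] spec[of _ 1])
    define U where "U = (gen_derivation A B ^^ n) Y"
    have U: "U \<in> J" using dense by (auto simp: dense_wrt_def U_def)
    have "S - U \<in> J"
      using add_mem[OF S scaleC_mem[OF U, of "- 1"]] by (simp add: scaleC_minus_left scaleC_one)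
    then have "norm (S - U) \<le> 1" using norm_le_N[of "S - U"] n by (simp add: U_def)
    have "norm (P ((S - U) q)) \<le> norm P * (norm (S - U) * norm q)"
      by (intro order_trans[OF norm_blinfun] mult_left_mono norm_blinfun) simp
    also have "\<dots> \<le> norm P * (1 * norm q)"
      using \<open>norm (S - U) \<le> 1\<close> by (intro mult_left_mono mult_right_mono) auto
    finally have "norm (P ((S - U) q)) \<le> norm P * norm q" by simp
    moreover have "P (S q) = P ((S - U) q) + P (U q)"
      by (simp add: blinfun.diff_left blinfun.diff_right)
    moreover have "norm (P (U q)) \<le> K" using orbit[of n] by (simp add: U_def)
    ultimately show ?thesis
      using norm_triangle_ineq[of "P ((S - U) q)" "P (U q)"] by (simp add: M_def)
  qed
  \<comment> \<open>A linear map that is bounded on a whole vector space vanishes.\<close>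
  have zero: "P (S q) = 0" if S: "S \<in> J" for S
  proof (rule ccontr)
    assume nz: "P (S q) \<noteq> 0"
    define t where "t = (M + 1) / norm (P (S q))"
    have "t *\<^sub>R S \<in> J" using scaleC_mem[OF S, of "complex_of_real t"] by (simp add: scaleC_of_real)
    then have "\<bar>t\<bar> * norm (P (S q)) \<le> M"
      using bound[of "t *\<^sub>R S"] by (simp add: blinfun.scaleR_left blinfun.scaleR_right)
    moreover have "t * norm (P (S q)) = M + 1" using nz by (simp add: t_def)
    moreover have "t * norm (P (S q)) \<le> \<bar>t\<bar> * norm (P (S q))" by (intro mult_right_mono) auto
    ultimately show False by linarith
  qed
  obtain g :: "'a \<Rightarrow>\<^sub>L complex" where g: "g \<in> bounded_ops" "g q \<noteq> 0"
    using exists_complex_functional[of q] x0 by (auto simp: q_def)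
  define S where "S = rank_one g (inverse (g q) *\<^sub>C x\<^sub>1)"
  have "S q = x\<^sub>1" using g(2) by (simp add: S_def rank_one.rep_eq scaleC_scaleC scaleC_one)
  moreover have "S \<in> J" unfolding S_def by (rule rank_one_mem[OF g(1)])
  ultimately show False using zero x1 by metis
qed

end
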